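(* Let $m$ be a non-negative integer, let $I=(a,b)$ be an open interval with $-\infty\le a\le b\le+\infty$, let $f\in C^{(m)}(I)$, and let $\epsilon\in C^+(I)$. Then there exists a function $g\in H(\mathbb{C}\setminus I^c)$, where $I^c=\mathbb{R}\setminus I$, such that $$|f^{(i)}(x)-g^{(i)}(x)|<\epsilon(x)\quad\text{for all } x\in I \text{ and all } i=0,1,\dots,m.$$
   Context: For an open interval $I=(a,b)\subset\mathbb{R}$ and $m=0,1,2,\dots$, $C^{(m)}(I)$ (also written $C^m(I)$) denotes the space of functions $f:I\to\mathbb{C}$ whose derivatives $f^{(0)}=f,f^{(1)},\dots,f^{(m)}$ exist and are continuous on $I$. $C^+(I)$ denotes the set of positive (strictly positive real-valued) continuous functions on $I$. $I^c=\mathbb{R}\setminus I$ is the complement of $I$ in $\mathbb{R}$ (not in $\mathbb{C}$), viewed as a subset of $\mathbb{C}$. For an open set $U\subset\mathbb{C}$, $H(U)$ is the family of holomorphic functions on $U$. For $x\in I$, $g^{(i)}(x)$ is the $i$-th complex derivative of $g$ at $x$ (equivalently, the $i$-th derivative of the restriction $g|_I$). *)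

theory Defs
  imports "HOL-Analysis.Analysis" "HOL-Complex_Analysis.Complex_Analysis"
begin

text \<open>
  Iterated derivative of a function of a real variable. On an open set its values depend only on
  the values of the function on that set, so a function on an open interval is represented by an
  arbitrary total extension. It is meaningful only where the lower derivatives are differentiable,
  which is what \<open>C_m_on\<close> requires.
\<close>

definition iter_vector_deriv :: "nat \<Rightarrow> (real \<Rightarrow> complex) \<Rightarrow> real \<Rightarrow> complex" where
  "iter_vector_deriv i f = ((\<lambda>h x. vector_derivative h (at x)) ^^ i) f"

definition C_m_on :: "nat \<Rightarrow> real set \<Rightarrow> (real \<Rightarrow> complex) \<Rightarrow> bool" where
  "C_m_on m I f \<longleftrightarrow>
     (\<forall>i<m. \<forall>x\<in>I. iter_vector_deriv i f differentiable (at x)) \<and>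
     (\<forall>i\<le>m. continuous_on I (iter_vector_deriv i f))"

end

theory Submission
  imports Defs
begin

text \<open>
  Write \<open>I\<close> for the interval and \<open>U\<close> for the plane slit along \<open>\<real> - I\<close>. The proof is an induction on the
  number \<open>m\<close> of derivatives: a Carleman theorem for \<open>m = 0\<close>, and an integration argument that
  raises \<open>m\<close> by one.

  For \<open>m = 0\<close> (\<open>Carleman_approximation\<close>), let \<open>\<phi> z = z\<^sup>2 + 1 / (z - a)\<^sup>2 + 1 / (z - b)\<^sup>2\<close>, where the term of
  an infinite end point is dropped. This function is holomorphic on \<open>U\<close>, and its restriction \<open>\<rho>\<close> to
  \<open>I\<close> is nonnegative with relatively compact sublevel sets. The error of the current approximant is
  cut off to the region \<open>\<rho> \<ge> t\<close>, approximated there by a polynomial, and the polynomial is multiplied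
  by \<open>1 - exp (- (\<phi> / r) ^ N)\<close> with \<open>r\<close> slightly below \<open>t\<close>. For large \<open>N\<close> this factor is almost \<open>1\<close>
  where \<open>\<rho> \<ge> t\<close>, lies in \<open>[0, 1]\<close> on all of \<open>I\<close>, and is almost \<open>0\<close> where \<open>\<bar>\<phi>\<bar> \<le> s < r\<close>. The corrections
  therefore sum locally uniformly on \<open>U\<close>, and the error stays controlled on larger and larger
  parts of \<open>I\<close>.

  For the step from \<open>m\<close> to \<open>m + 1\<close> (\<open>jet_dense_Suc\<close>), approximate \<open>f'\<close> to order \<open>m\<close> by \<open>h\<close> and let \<open>H\<close> be a
  primitive of \<open>h\<close>, which exists because \<open>U\<close> is starlike. If the error of \<open>h\<close> is dominated by the
  product of an integrable weight and a function \<open>\<mu>\<close> that decreases towards the ends of \<open>I\<close>, then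
  \<open>f - H\<close> has limits at both ends, and its distance to the respective limit is at most \<open>\<mu>\<close>
  (\<open>settles_if_derivative_small\<close>). An additive constant removes one limit. The other is removed by a
  multiple of a holomorphic function \<open>V\<close> that passes from one constant to a different one and has
  small derivatives; \<open>V\<close> is a primitive of an order-\<open>m\<close> approximant of a bump function
  (\<open>transition_function\<close>).
\<close>

section \<open>Tolerances bounded below on compact sets\<close>

text \<open>
  Tolerances are only required to have a positive lower bound on each compact subset of \<open>I\<close>. Unlike
  continuity, this property is immediately inherited by running infima, which supply
  the monotone tolerances of the integration step.
\<close>

definition locally_bounded_below :: "real set \<Rightarrow> (real \<Rightarrow> real) \<Rightarrow> bool" where
  "locally_bounded_below I e \<longleftrightarrow>
     (\<forall>K. compact K \<longrightarrow> K \<subseteq> I \<longrightarrow> (\<exists>c>0. \<forall>x\<in>K. c \<le> e x))"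

lemma locally_bounded_belowE:
  assumes "locally_bounded_below I e" "compact K" "K \<subseteq> I"
  obtains c where "c > 0" "\<And>x. x \<in> K \<Longrightarrow> c \<le> e x"
proof -
  have "\<exists>c>0. \<forall>x\<in>K. c \<le> e x" using assms(1-3) unfolding locally_bounded_below_def by simp
  then show thesis using that by auto
qed

lemma locally_bounded_below_pos:
  assumes "locally_bounded_below I e" "x \<in> I"
  shows "e x > 0"
proof -
  obtain c where "c > 0" "\<And>y. y \<in> {x} \<Longrightarrow> c \<le> e y"
    using locally_bounded_belowE[of I e "{x}"] assms by auto
  then show ?thesis by fastforce
qed

lemma locally_bounded_below_continuous:
  assumes "continuous_on I e" "\<And>x. x \<in> I \<Longrightarrow> e x > 0"
  shows "locally_bounded_below I e"
  unfolding locally_bounded_below_def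
proof (intro allI impI)
  fix K assume K: "compact K" "K \<subseteq> I"
  show "\<exists>c>0. \<forall>x\<in>K. c \<le> e x"
  proof (cases "K = {}")
    case False
    then obtain x where "x \<in> K" "\<forall>y\<in>K. e x \<le> e y"
      using continuous_attains_inf[OF K(1) False continuous_on_subset[OF assms(1) K(2)]] by blast
    then show ?thesis using assms(2) K by blast
  qed (auto intro: exI[of _ 1])
qed

lemma locally_bounded_below_mult:
  assumes "locally_bounded_below I d" "locally_bounded_below I e"
  shows "locally_bounded_below I (\<lambda>x. d x * e x)"
  unfolding locally_bounded_below_def
proof (intro allI impI)
  fix K assume K: "compact K" "K \<subseteq> I"
  obtain c where "c > 0" "\<And>x. x \<in> K \<Longrightarrow> c \<le> d x"
    using locally_bounded_belowE[OF assms(1) K] by blast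
  moreover obtain c' where "c' > 0" "\<And>x. x \<in> K \<Longrightarrow> c' \<le> e x"
    using locally_bounded_belowE[OF assms(2) K] by blast
  ultimately have "c * c' > 0" "\<forall>x\<in>K. c * c' \<le> d x * e x"
    by (simp, metis less_imp_le mult_mono order.trans)
  then show "\<exists>c>0. \<forall>x\<in>K. c \<le> d x * e x" by blast
qed

section \<open>Carleman approximation without derivatives\<close>

lemma entire_approximation_on_compact:
  fixes h :: "real \<Rightarrow> complex"
  assumes "compact K" "continuous_on K h" "e > 0"
  obtains p where "p holomorphic_on UNIV" "\<And>x. x \<in> K \<Longrightarrow> cmod (h x - p (of_real x)) < e"
proof -
  obtain P where P: "polynomial_function P" "\<forall>x\<in>K. norm (h x - P x) < e"
    using Stone_Weierstrass_polynomial_function[OF assms] by blast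
  have "real_polynomial_function (Re \<circ> P)" "real_polynomial_function (Im \<circ> P)"
    using P(1) unfolding polynomial_function_def
    by (auto simp: bounded_linear_Re bounded_linear_Im)
  then obtain a n b l where re: "Re \<circ> P = (\<lambda>x. \<Sum>i\<le>n. a i * x ^ i)"
      and im: "Im \<circ> P = (\<lambda>x. \<Sum>i\<le>l. b i * x ^ i)"
    unfolding real_polynomial_function_iff_sum by (elim exE)
  define p where "p = (\<lambda>z::complex. (\<Sum>i\<le>n. of_real (a i) * z ^ i) + \<i> * (\<Sum>i\<le>l. of_real (b i) * z ^ i))"
  have "p (of_real x) = P x" for x
  proof -
    have "p (of_real x) = of_real ((Re \<circ> P) x) + \<i> * of_real ((Im \<circ> P) x)"
      unfolding p_def re im by simp
    also have "\<dots> = P x" by (simp add: complex_eq_iff)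
    finally show ?thesis .
  qed
  moreover have "p holomorphic_on UNIV"
    unfolding p_def by (intro holomorphic_intros)
  ultimately show ?thesis using that P(2) by metis
qed

text \<open>
  The factor is \<open>1 - exp (- (w / r) ^ N)\<close> with \<open>s < r < t\<close>: the power tends to \<open>0\<close> for \<open>\<bar>w\<bar> \<le> s\<close> and to
  infinity for real \<open>w \<ge> t\<close>. In between, on the real axis, the values stay in \<open>[0, 1]\<close>, so the
  transition region costs nothing.
\<close>

lemma damping_factor:
  fixes s t :: real
  assumes "0 \<le> s" "s < t" "\<eta> > 0"
  obtains \<psi> where "\<psi> holomorphic_on UNIV"
    "\<And>w. cmod w \<le> s \<Longrightarrow> cmod (\<psi> w) \<le> \<eta>"
    "\<And>x. x \<ge> 0 \<Longrightarrow> cmod (\<psi> (of_real x)) \<le> 1"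
    "\<And>x. x \<ge> t \<Longrightarrow> cmod (1 - \<psi> (of_real x)) \<le> \<eta>"
proof -
  define r where "r = (s + t) / 2"
  have r: "r > 0" "s < r" "r < t" using assms by (auto simp: r_def)
  have "isCont exp (0::complex)" by simp
  then obtain d where d: "d > 0" "\<And>z::complex. cmod z < d \<Longrightarrow> cmod (exp z - 1) < \<eta>"
    unfolding continuous_at_eps_delta using assms(3) by (fastforce simp: dist_norm)
  have "(\<lambda>N. (s / r) ^ N) \<longlonglongrightarrow> 0"
    using r assms by (intro LIMSEQ_power_zero) simp
  then have "\<forall>\<^sub>F N in sequentially. (s / r) ^ N < d"
    using d(1) by (rule order_tendstoD)
  moreover have "\<forall>\<^sub>F N in sequentially. (t / r) ^ N > 1 / \<eta>"
  proof -
    obtain M where M: "1 / \<eta> < (t / r) ^ M" using real_arch_pow[of "t / r"] r by auto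
    have "(t / r) ^ M \<le> (t / r) ^ N" if "M \<le> N" for N
      using that r by (intro power_increasing) auto
    with M show ?thesis unfolding eventually_sequentially by (meson less_le_trans)
  qed
  ultimately obtain N where N: "(s / r) ^ N < d" "(t / r) ^ N > 1 / \<eta>"
    using eventually_happens'[OF sequentially_bot eventually_conj] by blast
  define \<psi> where "\<psi> = (\<lambda>w::complex. 1 - exp (- ((w / of_real r) ^ N)))"
  have real: "\<psi> (of_real x) = of_real (1 - exp (- ((x / r) ^ N)))" for x
    unfolding \<psi>_def by (simp add: exp_of_real[symmetric])
  show ?thesis
  proof
    show "\<psi> holomorphic_on UNIV"
      unfolding \<psi>_def using r by (intro holomorphic_intros) auto
  next
    fix w :: complex assume w: "cmod w \<le> s"
    have "cmod (- ((w / of_real r) ^ N)) = (cmod w / r) ^ N"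
      using r by (simp add: norm_power norm_divide)
    also have "\<dots> \<le> (s / r) ^ N"
      using w r by (intro power_mono divide_right_mono) auto
    finally show "cmod (\<psi> w) \<le> \<eta>"
      using d(2)[of "- ((w / of_real r) ^ N)"] N(1) unfolding \<psi>_def
      by (simp add: norm_minus_commute)
  next
    fix x :: real assume "x \<ge> 0"
    then have "exp (- ((x / r) ^ N)) \<le> 1" using r by simp
    then show "cmod (\<psi> (of_real x)) \<le> 1"
      unfolding real norm_of_real using exp_ge_zero[of "- ((x / r) ^ N)"] by linarith
  next
    fix x :: real assume x: "x \<ge> t"
    have "1 / \<eta> < (x / r) ^ N"
      using N(2) x r by (smt (verit, best) divide_right_mono power_mono zero_le_divide_iff)
    also have "\<dots> < exp ((x / r) ^ N)" by (metis exp_gt_self)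
    finally have "exp (- ((x / r) ^ N)) < \<eta>"
      using assms(3) by (simp add: exp_minus field_simps)
    then show "cmod (1 - \<psi> (of_real x)) \<le> \<eta>"
      unfolding real of_real_diff of_real_1 by (simp add: norm_of_real)
  qed
qed

text \<open>
  The one input from the geometry of \<open>I\<close> and \<open>U\<close>: a holomorphic function on \<open>U\<close> that is
  real and proper on \<open>I\<close>. Its sublevel sets exhaust \<open>I\<close>, and the sets \<open>\<bar>\<phi> z\<bar> \<le> s\<close> measure
  which part of \<open>U\<close> a correction leaves almost unchanged.
\<close>

locale real_exhaustion =
  fixes I :: "real set" and U :: "complex set" and \<phi> :: "complex \<Rightarrow> complex" and \<rho> :: "real \<Rightarrow> real"
  assumes open_U: "open U"
    and real_in_U: "x \<in> I \<Longrightarrow> of_real x \<in> U"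
    and holo: "\<phi> holomorphic_on U"
    and phi_real: "x \<in> I \<Longrightarrow> \<phi> (of_real x) = of_real (\<rho> x)"
    and rho_nonneg: "x \<in> I \<Longrightarrow> 0 \<le> \<rho> x"
    and proper: "\<exists>C. compact C \<and> C \<subseteq> I \<and> {x \<in> I. \<rho> x \<le> t} \<subseteq> C"
begin

lemma continuous_on_restriction:
  assumes "g holomorphic_on U"
  shows "continuous_on I (\<lambda>x. g (of_real x))"
  using continuous_on_compose2[OF holomorphic_on_imp_continuous_on[OF assms], of I of_real] real_in_U
  by (auto intro!: continuous_intros)

lemma continuous_rho: "continuous_on I \<rho>"
proof -
  have "continuous_on I (\<lambda>x. Re (\<phi> (of_real x)))"
    by (intro continuous_intros continuous_on_restriction holo)
  then show ?thesis by (rule continuous_on_eq) (simp add: phi_real)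
qed

definition ramp :: "real \<Rightarrow> real \<Rightarrow> real" where
  "ramp t x = max 0 (min 1 (\<rho> x - t))"

text \<open>
  The order of the choices matters. The polynomial comes first, and its size on the disc of radius \<open>R\<close> and
  on \<open>C\<close> is then fixed; only afterwards is the damping factor made accurate enough to compensate this
  size. Where the ramp vanishes the polynomial is already small, and there the damping factor need
  only be bounded by \<open>1\<close>.
\<close>

lemma approximate_outer_part:
  fixes F :: "real \<Rightarrow> complex"
  assumes F: "continuous_on I F" and C: "compact C" "C \<subseteq> I" and st: "0 \<le> s" "s < t" and "\<eta> > 0"
  obtains g where "g holomorphic_on U"
    "\<And>z. z \<in> U \<Longrightarrow> cmod z \<le> R \<Longrightarrow> cmod (\<phi> z) \<le> s \<Longrightarrow> cmod (g z) \<le> \<eta>"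
    "\<And>x. x \<in> C \<Longrightarrow> cmod (of_real (ramp t x) * F x - g (of_real x)) \<le> \<eta>"
proof -
  define h where "h = (\<lambda>x. of_real (ramp t x) * F x)"
  have "continuous_on C h"
    unfolding h_def ramp_def
    by (intro continuous_intros continuous_on_subset[OF F] continuous_on_subset[OF continuous_rho] C)
  then obtain p where p: "p holomorphic_on UNIV" "\<And>x. x \<in> C \<Longrightarrow> cmod (h x - p (of_real x)) < \<eta> / 2"
    using entire_approximation_on_compact[OF C(1)] \<open>\<eta> > 0\<close> half_gt_zero by blast
  have contp: "continuous_on A p" for A
    using holomorphic_on_imp_continuous_on[OF p(1)] continuous_on_subset by blast
  have "compact (p ` (cball 0 R \<union> of_real ` C))"
    by (intro compact_continuous_image contp compact_Un compact_cball C continuous_intros)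
  then obtain B where B: "B > 0" "\<And>z. z \<in> cball 0 R \<union> of_real ` C \<Longrightarrow> cmod (p z) \<le> B"
    using compact_imp_bounded bounded_pos by (metis image_eqI)
  have "\<eta> / (2 * B) > 0" using B \<open>\<eta> > 0\<close> by simp
  from damping_factor[OF st this]
  obtain \<psi> where \<psi>: "\<psi> holomorphic_on UNIV"
    "\<And>w. cmod w \<le> s \<Longrightarrow> cmod (\<psi> w) \<le> \<eta> / (2 * B)"
    "\<And>x. x \<ge> 0 \<Longrightarrow> cmod (\<psi> (of_real x)) \<le> 1"
    "\<And>x. x \<ge> t \<Longrightarrow> cmod (1 - \<psi> (of_real x)) \<le> \<eta> / (2 * B)" by blast
  show ?thesis
  proof
    have "(\<psi> \<circ> \<phi>) holomorphic_on U"
      using holomorphic_on_compose_gen[OF holo \<psi>(1)] by auto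
    then show "(\<lambda>z. p z * \<psi> (\<phi> z)) holomorphic_on U"
      using holomorphic_on_subset[OF p(1)] by (auto intro!: holomorphic_intros simp: o_def)
  next
    fix z assume z: "z \<in> U" "cmod z \<le> R" "cmod (\<phi> z) \<le> s"
    have "cmod (p z * \<psi> (\<phi> z)) \<le> B * (\<eta> / (2 * B))"
      unfolding norm_mult using z by (intro mult_mono B \<psi>) (use B in auto)
    also have "\<dots> \<le> \<eta>" using B \<open>\<eta> > 0\<close> by simp
    finally show "cmod (p z * \<psi> (\<phi> z)) \<le> \<eta>" .
  next
    fix x assume x: "x \<in> C"
    then have xI: "x \<in> I" using C by blast
    show "cmod (of_real (ramp t x) * F x - p (of_real x) * \<psi> (\<phi> (of_real x))) \<le> \<eta>"
    proof (cases "\<rho> x \<ge> t")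
      case True
      have eq: "of_real (ramp t x) * F x - p (of_real x) * \<psi> (\<phi> (of_real x)) =
              (h x - p (of_real x)) + p (of_real x) * (1 - \<psi> (of_real (\<rho> x)))"
        by (simp add: h_def phi_real[OF xI] algebra_simps)
      have "cmod (p (of_real x) * (1 - \<psi> (of_real (\<rho> x)))) \<le> B * (\<eta> / (2 * B))"
        unfolding norm_mult using x True by (intro mult_mono B \<psi>) (use B in auto)
      moreover have "B * (\<eta> / (2 * B)) = \<eta> / 2" using B by simp
      ultimately show ?thesis
        unfolding eq using p(2)[OF x] norm_triangle_ineq[of "h x - p (of_real x)" "p (of_real x) * (1 - \<psi> (of_real (\<rho> x)))"]
        by linarith
    next
      case False
      then have "h x = 0" by (simp add: h_def ramp_def)
      then have "cmod (p (of_real x)) \<le> \<eta> / 2" using p(2)[OF x] by simp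
      then have "cmod (p (of_real x)) * cmod (\<psi> (of_real (\<rho> x))) \<le> \<eta> / 2 * 1"
        using \<psi>(3)[OF rho_nonneg[OF xI]] by (intro mult_mono) (use \<open>\<eta> > 0\<close> in auto)
      moreover have "of_real (ramp t x) * F x = 0" using \<open>h x = 0\<close> by (simp add: h_def)
      ultimately show ?thesis
        unfolding phi_real[OF xI] \<open>of_real (ramp t x) * F x = 0\<close> using \<open>\<eta> > 0\<close> by (simp add: norm_mult)
    qed
  qed
qed

text \<open>
  The correction approximates \<open>ramp t * (f - G)\<close>. What remains of the error is \<open>(1 - ramp t) * (f - G)\<close>,
  which is dominated by the old error where \<open>\<rho> \<le> t + 1\<close> and vanishes beyond, plus the
  approximation error \<open>d * e\<close>.
\<close>

lemma exhaustion_step: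
  assumes f: "continuous_on I f" and e: "locally_bounded_below I e"
    and G: "G holomorphic_on U" and A: "0 \<le> A" and "0 < d"  "0 \<le> s" "s < t"
    and close: "\<And>x. x \<in> I \<Longrightarrow> \<rho> x \<le> t + 1 \<Longrightarrow> cmod (f x - G (of_real x)) \<le> A * e x"
  obtains G' where "G' holomorphic_on U"
    "\<And>x. x \<in> I \<Longrightarrow> \<rho> x \<le> t + 2 \<Longrightarrow> cmod (f x - G' (of_real x)) \<le> (A + d) * e x"
    "\<And>z. z \<in> U \<Longrightarrow> cmod z \<le> R \<Longrightarrow> cmod (\<phi> z) \<le> s \<Longrightarrow> cmod (G' z - G z) \<le> d"
proof -
  obtain C where C: "compact C" "C \<subseteq> I" "{x \<in> I. \<rho> x \<le> t + 2} \<subseteq> C" using proper by blast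
  obtain c where c: "c > 0" "\<And>x. x \<in> C \<Longrightarrow> c \<le> e x" using locally_bounded_belowE[OF e C(1,2)] by blast
  define \<eta> where "\<eta> = min d (d * c)"
  have "\<eta> > 0" using c \<open>0 < d\<close> by (simp add: \<eta>_def)
  have "continuous_on I (\<lambda>x. f x - G (of_real x))"
    by (intro continuous_intros f continuous_on_restriction G)
  from approximate_outer_part[OF this C(1,2) \<open>0 \<le> s\<close> \<open>s < t\<close> \<open>\<eta> > 0\<close>, of R]
  obtain g where g: "g holomorphic_on U"
    "\<And>z. z \<in> U \<Longrightarrow> cmod z \<le> R \<Longrightarrow> cmod (\<phi> z) \<le> s \<Longrightarrow> cmod (g z) \<le> \<eta>"
    "\<And>x. x \<in> C \<Longrightarrow> cmod (of_real (ramp t x) * (f x - G (of_real x)) - g (of_real x)) \<le> \<eta>"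
    by blast
  show ?thesis
  proof
    show "(\<lambda>z. G z + g z) holomorphic_on U" using G g(1) by (intro holomorphic_intros)
  next
    fix x assume x: "x \<in> I" "\<rho> x \<le> t + 2"
    then have xC: "x \<in> C" using C by blast
    have ex: "e x > 0" using c xC by force
    have "\<eta> \<le> d * e x"
      using mult_left_mono[OF c(2)[OF xC], of d] \<open>0 < d\<close> unfolding \<eta>_def by linarith
    with g(3)[OF xC] have gb: "cmod (of_real (ramp t x) * (f x - G (of_real x)) - g (of_real x)) \<le> d * e x"
      by simp
    have ramp: "0 \<le> ramp t x" "ramp t x \<le> 1" by (auto simp: ramp_def)
    have "cmod (of_real (1 - ramp t x) * (f x - G (of_real x))) \<le> A * e x"
    proof (cases "\<rho> x \<le> t + 1")
      case True
      have "\<bar>1 - ramp t x\<bar> * cmod (f x - G (of_real x)) \<le> 1 * (A * e x)"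
        using ramp close[OF x(1) True] by (intro mult_mono) auto
      then show ?thesis unfolding norm_mult norm_of_real by simp
    next
      case False
      then have "ramp t x = 1" by (simp add: ramp_def)
      then show ?thesis using A ex by simp
    qed
    moreover have eq: "f x - (G (of_real x) + g (of_real x)) = of_real (1 - ramp t x) * (f x - G (of_real x))
         + (of_real (ramp t x) * (f x - G (of_real x)) - g (of_real x))" by (simp add: algebra_simps)
    ultimately show "cmod (f x - (G (of_real x) + g (of_real x))) \<le> (A + d) * e x"
      unfolding eq distrib_right using gb norm_triangle_ineq[of "of_real (1 - ramp t x) * (f x - G (of_real x))"
          "of_real (ramp t x) * (f x - G (of_real x)) - g (of_real x)"]
      by linarith
  next
    fix z assume "z \<in> U" "cmod z \<le> R" "cmod (\<phi> z) \<le> s"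
    then show "cmod (G z + g z - G z) \<le> d" using g(2)[of z] by (simp add: \<eta>_def)
  qed
qed

text \<open>
  The admissible error on \<open>\<rho> \<le> n + 2\<close> at stage \<open>n\<close> is \<open>(2 - 2\<^sup>-\<^sup>n) * e / 4\<close>; it increases with \<open>n\<close>, which leaves
  room for the next correction, and never exceeds \<open>e / 2\<close>. The \<open>n\<close>-th correction is at most
  \<open>2\<^sup>-\<^sup>n\<close> where \<open>\<bar>z\<bar> \<le> n\<close> and \<open>\<bar>\<phi> z\<bar> \<le> n\<close>, and every compact subset of \<open>U\<close> satisfies both bounds
  for large \<open>n\<close>.
\<close>

theorem Carleman_approximation:
  assumes f: "continuous_on I f" and e: "locally_bounded_below I e"
  obtains g where "g holomorphic_on U" "\<And>x. x \<in> I \<Longrightarrow> cmod (f x - g (of_real x)) < e x"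
proof -
  define e' where "e' = (\<lambda>x. 1/4 * e x)"
  have "locally_bounded_below I (\<lambda>x::real. 1/4)"
    by (rule locally_bounded_below_continuous) auto
  then have e': "locally_bounded_below I e'"
    unfolding e'_def by (rule locally_bounded_below_mult[OF _ e])
  define P where "P = (\<lambda>(n::nat) G. G holomorphic_on U \<and>
     (\<forall>x\<in>I. \<rho> x \<le> real n + 2 \<longrightarrow> cmod (f x - G (of_real x)) \<le> (2 - (1/2)^n) * e' x))"
  define Q where "Q = (\<lambda>(n::nat) G G'. \<forall>z\<in>U. cmod z \<le> real n \<longrightarrow> cmod (\<phi> z) \<le> real n \<longrightarrow>
     cmod (G' z - G z) \<le> (1/2)^n)"
  have "\<exists>G. \<forall>n. P n (G n) \<and> Q n (G n) (G (Suc n))"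
  proof (rule dependent_nat_choice)
    obtain C where C: "compact C" "C \<subseteq> I" "{x \<in> I. \<rho> x \<le> 2} \<subseteq> C" using proper by blast
    obtain c where c: "c > 0" "\<And>x. x \<in> C \<Longrightarrow> c \<le> e' x" using locally_bounded_belowE[OF e' C(1,2)] by blast
    obtain p where "p holomorphic_on UNIV" "\<And>x. x \<in> C \<Longrightarrow> cmod (f x - p (of_real x)) < c"
      using entire_approximation_on_compact[OF C(1) continuous_on_subset[OF f C(2)] c(1)] by blast
    note p = this
    have "cmod (f x - p (of_real x)) \<le> e' x" if "x \<in> I" "\<rho> x \<le> 2" for x
    proof -
      have "x \<in> C" using C that by blast
      then show ?thesis using p(2)[of x] c(2)[of x] by linarith
    qed
    then have "P 0 p" unfolding P_def using holomorphic_on_subset[OF p(1)] by simp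
    then show "\<exists>G. P 0 G" by blast
  next
    fix G n assume "P n G"
    then have G: "G holomorphic_on U" "\<And>x. x \<in> I \<Longrightarrow> \<rho> x \<le> (real n + 1) + 1 \<Longrightarrow>
        cmod (f x - G (of_real x)) \<le> (2 - (1/2)^n) * e' x"
      unfolding P_def by (auto simp: add.commute)
    have le1: "(1/2::real)^n \<le> 1" by (rule power_le_one) auto
    have A: "0 \<le> 2 - (1/2::real)^n" and d: "0 < (1/2::real)^Suc n"
      using le1 by auto
    have st: "0 \<le> real n" "real n < real n + 1" by auto
    obtain G' where G': "G' holomorphic_on U"
       "\<And>x. x \<in> I \<Longrightarrow> \<rho> x \<le> (real n + 1) + 2 \<Longrightarrow> cmod (f x - G' (of_real x)) \<le> (2 - (1/2)^n + (1/2)^Suc n) * e' x"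
       "\<And>z. z \<in> U \<Longrightarrow> cmod z \<le> real n \<Longrightarrow> cmod (\<phi> z) \<le> real n \<Longrightarrow> cmod (G' z - G z) \<le> (1/2)^Suc n"
      using exhaustion_step[OF f e' G(1) A d st G(2), of "real n"] by blast
    have "P (Suc n) G'" unfolding P_def using G' by (auto simp: algebra_simps)
    moreover have "Q n G G'"
      unfolding Q_def
    proof (intro ballI impI)
      fix z assume "z \<in> U" "cmod z \<le> real n" "cmod (\<phi> z) \<le> real n"
      from G'(3)[OF this] show "cmod (G' z - G z) \<le> (1/2)^n" by (rule order.trans) simp
    qed
    ultimately show "\<exists>G'. P (Suc n) G' \<and> Q n G G'" by blast
  qed
  then obtain G where G: "\<And>n. P n (G n)" "\<And>n. Q n (G n) (G (Suc n))" by blast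
  have holG: "G n holomorphic_on U" for n using G(1)[of n] by (simp add: P_def)
  define D where "D = (\<lambda>n z. G (Suc n) z - G n z)"
  define g where "g = (\<lambda>z. G 0 z + suminf (\<lambda>n. D n z))"
  have unif: "uniform_limit L G g sequentially" if L: "compact L" "L \<subseteq> U" for L
  proof -
    have "bounded (L \<union> \<phi> ` L)"
      using L holomorphic_on_imp_continuous_on[OF holo]
      by (intro compact_imp_bounded compact_Un compact_continuous_image) (auto intro: continuous_on_subset)
    then obtain B where B: "\<And>z. z \<in> L \<Longrightarrow> cmod z \<le> B \<and> cmod (\<phi> z) \<le> B"
      unfolding bounded_iff by blast
    obtain N :: nat where N: "B \<le> real N" using real_arch_simple by blast
    have "cmod (D n z) \<le> (1/2)^n" if "n \<ge> N" "z \<in> L" for n z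
    proof -
      have "cmod z \<le> real n" "cmod (\<phi> z) \<le> real n" using B[OF that(2)] N that(1) by auto
      then show ?thesis using G(2)[of n] that L unfolding Q_def D_def by auto
    qed
    then have ev: "\<forall>\<^sub>F n in sequentially. \<forall>z\<in>L. cmod (D n z) \<le> (1/2)^n"
      unfolding eventually_sequentially by blast
    have "uniform_limit L (\<lambda>n z. \<Sum>i<n. D i z) (\<lambda>z. suminf (\<lambda>i. D i z)) sequentially"
      by (rule Weierstrass_m_test_ev[OF ev]) (simp add: summable_geometric)
    then have "uniform_limit L (\<lambda>n z. G 0 z + (\<Sum>i<n. D i z)) g sequentially"
      unfolding g_def by (intro uniform_limit_intros)
    moreover have "(\<Sum>i<n. D i z) = G n z - G 0 z" for n z
      unfolding D_def by (rule sum_lessThan_telescope)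
    ultimately show ?thesis by simp
  qed
  show ?thesis
  proof
    show "g holomorphic_on U"
    proof (rule holomorphic_uniform_sequence[OF open_U holG])
      fix z assume "z \<in> U"
      then obtain d where "d > 0" "cball z d \<subseteq> U" using open_U open_contains_cball by blast
      then show "\<exists>d>0. cball z d \<subseteq> U \<and> uniform_limit (cball z d) G g sequentially"
        using unif[of "cball z d"] by auto
    qed
  next
    fix x assume x: "x \<in> I"
    have ex: "e' x > 0" by (rule locally_bounded_below_pos[OF e' x])
    have lim: "(\<lambda>n. G n (of_real x)) \<longlonglongrightarrow> g (of_real x)"
      using tendsto_uniform_limitI[OF unif[of "{of_real x}"], of "of_real x"] real_in_U[OF x] by simp
    obtain N :: nat where N: "\<rho> x \<le> real N" using real_arch_simple by blast
    have "cmod (f x - G n (of_real x)) \<le> 2 * e' x" if "n \<ge> N" for n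
    proof -
      have "cmod (f x - G n (of_real x)) \<le> (2 - (1/2)^n) * e' x"
        using G(1)[of n] x N that unfolding P_def by auto
      also have "\<dots> \<le> 2 * e' x" using ex by (intro mult_right_mono) auto
      finally show ?thesis .
    qed
    then have "cmod (f x - g (of_real x)) \<le> 2 * e' x"
      by (intro tendsto_upperbound[OF tendsto_norm[OF tendsto_diff[OF tendsto_const lim]]])
         (auto simp: eventually_sequentially)
    then show "cmod (f x - g (of_real x)) < e x" using ex by (simp add: e'_def)
  qed
qed

end

section \<open>Functions with small derivative settle down at both ends\<close>

text \<open>
  The constants \<open>c\<close> and \<open>c'\<close> stand for the limits of \<open>E\<close> at the two ends of \<open>I\<close>. Only the distance to them is
  recorded, because that is all the correction of a primitive has to know. Both bounds include
  \<open>p\<close>, so that \<open>c' - c\<close> can be estimated there.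
\<close>

definition settles :: "real set \<Rightarrow> real \<Rightarrow> (real \<Rightarrow> real) \<Rightarrow> (real \<Rightarrow> complex) \<Rightarrow> complex \<Rightarrow> complex \<Rightarrow> bool" where
  "settles I p \<mu> E c c' \<longleftrightarrow>
     (\<forall>x\<in>I. x \<le> p \<longrightarrow> cmod (E x - c) \<le> \<mu> x) \<and> (\<forall>x\<in>I. p \<le> x \<longrightarrow> cmod (E x - c') \<le> \<mu> x)"

definition decreasing_away_from :: "real \<Rightarrow> real set \<Rightarrow> (real \<Rightarrow> real) \<Rightarrow> bool" where
  "decreasing_away_from p I \<mu> \<longleftrightarrow> (\<forall>y\<in>I. \<forall>x\<in>closed_segment p y. \<mu> y \<le> \<mu> x)"

lemma settles_jump:
  assumes "settles I p \<mu> E c c'" "p \<in> I"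
  shows "cmod (c' - c) \<le> 2 * \<mu> p"
proof -
  have "cmod (E p - c) \<le> \<mu> p" "cmod (E p - c') \<le> \<mu> p"
    using assms unfolding settles_def by auto
  then show ?thesis using norm_triangle_ineq4[of "E p - c" "E p - c'"] by simp
qed

text \<open>
  The weight \<open>1 / (1 + t\<^sup>2)\<close> is the derivative of \<open>arctan\<close>, which is bounded; so one integrable weight on the
  whole line serves bounded and unbounded intervals alike.
\<close>

lemma arctan_dominated_increment:
  fixes E :: "real \<Rightarrow> complex"
  assumes E: "\<And>t. t \<in> closed_segment x y \<Longrightarrow> (E has_vector_derivative E' t) (at t)"
    and bound: "\<And>t. t \<in> closed_segment x y \<Longrightarrow> cmod (E' t) \<le> M / (4 * (1 + t\<^sup>2))"
  shows "cmod (E y - E x) \<le> M / 4 * \<bar>arctan y - arctan x\<bar>"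
proof -
  have *: "cmod (E v - E u) \<le> M / 4 * arctan v - M / 4 * arctan u"
    if uv: "u < v" "{u..v} \<subseteq> closed_segment x y" for u v
  proof (rule differentiable_bound_general[OF uv(1), of E "\<lambda>t. M / 4 * arctan t" E' "\<lambda>t. M / (4 * (1 + t\<^sup>2))"])
    show "continuous_on {u..v} E"
      using E uv(2) by (intro continuous_at_imp_continuous_on ballI)
        (meson has_vector_derivative_continuous in_mono)
    show "continuous_on {u..v} (\<lambda>t. M / 4 * arctan t)" by (intro continuous_intros)
  next
    fix t assume t: "u < t" "t < v"
    then have "t \<in> closed_segment x y" using uv(2) by auto
    then show "(E has_vector_derivative E' t) (at t)" "cmod (E' t) \<le> M / (4 * (1 + t\<^sup>2))"
      using E bound by auto
    have "((\<lambda>t. M / 4 * arctan t) has_real_derivative M / 4 * inverse (1 + t\<^sup>2)) (at t)"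
      by (intro DERIV_cmult DERIV_arctan)
    then show "((\<lambda>t. M / 4 * arctan t) has_vector_derivative M / (4 * (1 + t\<^sup>2))) (at t)"
      unfolding has_real_derivative_iff_has_vector_derivative by (simp add: field_simps)
  qed
  consider "x < y" | "x = y" | "y < x" by linarith
  then show ?thesis
  proof cases
    case 1
    then show ?thesis using *[of x y] arctan_monotone[of x y]
      by (simp add: closed_segment_eq_real_ivl algebra_simps)
  next
    case 3
    then show ?thesis using *[of y x] arctan_monotone[of y x]
      by (simp add: closed_segment_eq_real_ivl norm_minus_commute algebra_simps)
  qed auto
qed

text \<open>
  Along the cofinal sequence \<open>s\<close> the values of \<open>arctan\<close> form a Cauchy sequence, hence so do those of \<open>E\<close>. Beyond \<open>x\<close> the
  derivative of \<open>E\<close> is at most \<open>\<mu> x / 4\<close> times that of \<open>arctan\<close>, whose total variation is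
  \<open>\<pi> < 4\<close>; this is where the monotonicity of \<open>\<mu>\<close> enters.
\<close>

lemma limit_along_one_side:
  fixes E :: "real \<Rightarrow> complex"
  assumes I: "convex I" "p \<in> I" and \<mu>: "decreasing_away_from p I \<mu>" "\<And>x. x \<in> I \<Longrightarrow> 0 \<le> \<mu> x"
    and E: "\<And>t. t \<in> I \<Longrightarrow> (E has_vector_derivative E' t) (at t)"
    and bound: "\<And>t. t \<in> I \<Longrightarrow> cmod (E' t) \<le> \<mu> t / (4 * (1 + t\<^sup>2))"
    and s: "\<And>n. s n \<in> I" "monoseq s"
    and cofinal: "\<And>x. x \<in> A \<Longrightarrow> \<forall>\<^sub>F n in sequentially. x \<in> closed_segment p (s n)"
  obtains c where "\<And>x. x \<in> A \<Longrightarrow> cmod (E x - c) \<le> \<mu> x"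
proof -
  have inc: "cmod (E y - E x) \<le> \<mu> x / 4 * \<bar>arctan y - arctan x\<bar>"
    if y: "y \<in> I" and x: "x \<in> closed_segment p y" for x y
  proof (rule arctan_dominated_increment)
    fix t assume t: "t \<in> closed_segment x y"
    have "t \<in> closed_segment p y" "x \<in> closed_segment p t"
      using t x by (auto simp: closed_segment_eq_real_ivl split: if_splits)
    moreover have tI: "t \<in> I" using calculation(1) I y closed_segment_subset by blast
    ultimately have "\<mu> t \<le> \<mu> x" using \<mu>(1) unfolding decreasing_away_from_def by blast
    then have "\<mu> t / (4 * (1 + t\<^sup>2)) \<le> \<mu> x / (4 * (1 + t\<^sup>2))"
      by (intro divide_right_mono) auto
    then show "cmod (E' t) \<le> \<mu> x / (4 * (1 + t\<^sup>2))" using bound[OF tI] by linarith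
    show "(E has_vector_derivative E' t) (at t)" by (rule E[OF tI])
  qed
  have "Bseq (\<lambda>n. arctan (s n))"
  proof (rule BseqI')
    show "norm (arctan (s n)) \<le> pi / 2" for n
      unfolding real_norm_def using arctan_bounded[of "s n"] by linarith
  qed
  moreover have "monoseq (\<lambda>n. arctan (s n))"
    using s(2) unfolding monoseq_def by (auto simp: arctan_le_iff)
  ultimately have "Cauchy (\<lambda>n. arctan (s n))"
    using Bseq_monoseq_convergent convergent_Cauchy by blast
  have pmax: "\<mu> x \<le> \<mu> p" if "x \<in> I" for x
    using \<mu>(1) that unfolding decreasing_away_from_def by auto
  have step: "cmod (E (s m) - E (s n)) \<le> \<mu> p / 4 * \<bar>arctan (s m) - arctan (s n)\<bar>" for m n
  proof (rule arctan_dominated_increment)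
    fix t assume "t \<in> closed_segment (s n) (s m)"
    then have tI: "t \<in> I" using I(1) s(1) closed_segment_subset by blast
    have "\<mu> t / (4 * (1 + t\<^sup>2)) \<le> \<mu> p / (4 * (1 + t\<^sup>2))"
      using pmax[OF tI] by (intro divide_right_mono) auto
    then show "cmod (E' t) \<le> \<mu> p / (4 * (1 + t\<^sup>2))" using bound[OF tI] by linarith
    show "(E has_vector_derivative E' t) (at t)" by (rule E[OF tI])
  qed
  have "Cauchy (\<lambda>n. E (s n))"
    unfolding Cauchy_def
  proof (intro allI impI)
    fix \<epsilon> :: real assume "\<epsilon> > 0"
    \<comment> \<open>Adding \<open>1\<close> makes the Lipschitz constant positive, so that one may divide by it.\<close>
    define K where "K = \<mu> p / 4 + 1"
    have K: "K > 0" using \<mu>(2)[OF I(2)] by (simp add: K_def)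
    then obtain M where M: "\<And>m n. m \<ge> M \<Longrightarrow> n \<ge> M \<Longrightarrow> dist (arctan (s m)) (arctan (s n)) < \<epsilon> / K"
      using \<open>Cauchy (\<lambda>n. arctan (s n))\<close> \<open>\<epsilon> > 0\<close> unfolding Cauchy_def by (meson divide_pos_pos)
    have "dist (E (s m)) (E (s n)) < \<epsilon>" if "m \<ge> M" "n \<ge> M" for m n
    proof -
      have "cmod (E (s m) - E (s n)) \<le> K * \<bar>arctan (s m) - arctan (s n)\<bar>"
        unfolding K_def by (rule order.trans[OF step mult_right_mono]) simp_all
      also have "\<dots> < K * (\<epsilon> / K)"
        using M[OF that] K by (intro mult_strict_left_mono) (auto simp: dist_real_def)
      finally show ?thesis using K by (simp add: dist_norm)
    qed
    then show "\<exists>M. \<forall>m\<ge>M. \<forall>n\<ge>M. dist (E (s m)) (E (s n)) < \<epsilon>" by blast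
  qed
  then obtain c where c: "(\<lambda>n. E (s n)) \<longlonglongrightarrow> c"
    using Cauchy_convergent convergent_def by blast
  have "cmod (E x - c) \<le> \<mu> x" if x: "x \<in> A" for x
  proof (rule tendsto_upperbound[OF tendsto_norm[OF tendsto_diff[OF tendsto_const c]]])
    show "\<forall>\<^sub>F n in sequentially. cmod (E x - E (s n)) \<le> \<mu> x"
      using cofinal[OF x]
    proof eventually_elim
      fix n assume n: "x \<in> closed_segment p (s n)"
      then have "x \<in> I" using I s(1) closed_segment_subset by blast
      have "\<bar>arctan (s n) - arctan x\<bar> \<le> 4"
        using arctan_bounded[of "s n"] arctan_bounded[of x] pi_less_4 by linarith
      then have "\<mu> x / 4 * \<bar>arctan (s n) - arctan x\<bar> \<le> \<mu> x / 4 * 4"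
        using \<mu>(2)[OF \<open>x \<in> I\<close>] by (intro mult_left_mono) auto
      then show "cmod (E x - E (s n)) \<le> \<mu> x"
        using inc[OF s(1) n] by (simp add: norm_minus_commute)
    qed
  qed simp
  then show ?thesis using that by blast
qed

lemma convex_einterval: "convex (einterval a b)"
  by (auto simp: is_interval_convex_1[symmetric] is_interval_1 einterval_iff)
     (metis ereal_less_eq(3) less_le_trans, metis ereal_less_eq(3) le_less_trans)

lemma settles_if_derivative_small:
  fixes E :: "real \<Rightarrow> complex"
  assumes p: "p \<in> einterval a b" and \<mu>: "decreasing_away_from p (einterval a b) \<mu>"
      "\<And>x. x \<in> einterval a b \<Longrightarrow> 0 \<le> \<mu> x"
    and E: "\<And>t. t \<in> einterval a b \<Longrightarrow> (E has_vector_derivative E' t) (at t)"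
    and bound: "\<And>t. t \<in> einterval a b \<Longrightarrow> cmod (E' t) \<le> \<mu> t / (4 * (1 + t\<^sup>2))"
  obtains c c' where "settles (einterval a b) p \<mu> E c c'"
proof -
  have "a < b" using p less_trans unfolding einterval_iff by blast
  obtain u l :: "nat \<Rightarrow> real" where ul:
    "einterval a b = (\<Union>i. {l i .. u i})"
    "incseq u" "decseq l" "\<And>i. l i < u i" "\<And>i. a < l i" "\<And>i. u i < b"
    "l \<longlonglongrightarrow> a" "u \<longlonglongrightarrow> b"
    by (blast intro: einterval_Icc_approximation[OF \<open>a < b\<close>])
  have mem: "l n \<in> einterval a b" "u n \<in> einterval a b" for n
    using ul(1) ul(4)[of n] by (auto intro!: exI[of _ n] less_imp_le)
  have sandwich: "\<forall>\<^sub>F n in sequentially. l n \<le> x \<and> x \<le> u n" if "x \<in> einterval a b" for x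
  proof -
    have "x \<in> (\<Union>i. {l i .. u i})" using that unfolding ul(1) .
    then obtain N where "l N \<le> x" "x \<le> u N" by auto
    then have "l n \<le> x \<and> x \<le> u n" if "n \<ge> N" for n
      using that incseqD[OF ul(2) that] decseqD[OF ul(3) that] by linarith
    then show ?thesis unfolding eventually_sequentially by blast
  qed
  obtain c' where "\<And>x. x \<in> einterval a b \<inter> {p..} \<Longrightarrow> cmod (E x - c') \<le> \<mu> x"
  proof (rule limit_along_one_side[OF convex_einterval p \<mu> E bound mem(2)])
    show "monoseq u" using ul(2) by (simp add: incseq_imp_monoseq)
    fix x assume x: "x \<in> einterval a b \<inter> {p..}"
    then have "\<forall>\<^sub>F n in sequentially. l n \<le> x \<and> x \<le> u n" using sandwich by blast
    then show "\<forall>\<^sub>F n in sequentially. x \<in> closed_segment p (u n)"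
      by eventually_elim (use x in \<open>auto simp: closed_segment_eq_real_ivl\<close>)
  qed auto
  moreover obtain c where "\<And>x. x \<in> einterval a b \<inter> {..p} \<Longrightarrow> cmod (E x - c) \<le> \<mu> x"
  proof (rule limit_along_one_side[OF convex_einterval p \<mu> E bound mem(1)])
    show "monoseq l" using ul(3) by (simp add: decseq_imp_monoseq)
    fix x assume x: "x \<in> einterval a b \<inter> {..p}"
    then have "\<forall>\<^sub>F n in sequentially. l n \<le> x \<and> x \<le> u n" using sandwich by blast
    then show "\<forall>\<^sub>F n in sequentially. x \<in> closed_segment p (l n)"
      by eventually_elim (use x in \<open>auto simp: closed_segment_eq_real_ivl\<close>)
  qed auto
  ultimately have "settles (einterval a b) p \<mu> E c c'" unfolding settles_def by simp
  then show ?thesis by (rule that)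
qed

text \<open>
  The running infimum of \<open>e\<close> over the segment from \<open>p\<close> to \<open>x\<close> works: a compact subset of \<open>I\<close> together with \<open>p\<close> has
  a compact convex hull inside \<open>I\<close>, which contains all the segments involved.
\<close>

lemma decreasing_minorant:
  assumes e: "locally_bounded_below I e" and I: "convex I" "p \<in> I"
  obtains \<mu> where "locally_bounded_below I \<mu>" "decreasing_away_from p I \<mu>" "\<And>x. x \<in> I \<Longrightarrow> \<mu> x \<le> e x"
proof -
  define \<mu> where "\<mu> = (\<lambda>x. Inf (e ` closed_segment p x))"
  have segI: "closed_segment p x \<subseteq> I" if "x \<in> I" for x using I that closed_segment_subset by blast
  have bdd: "bdd_below (e ` closed_segment p x)" if "x \<in> I" for x
    by (rule locally_bounded_belowE[OF e compact_segment segI[OF that]]) (rule bdd_belowI2)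
  show ?thesis
  proof
    show "locally_bounded_below I \<mu>"
      unfolding locally_bounded_below_def
    proof (intro allI impI)
      fix K assume K: "compact K" "K \<subseteq> I"
      have "compact (convex hull (insert p K))" using K by (intro compact_convex_hull) auto
      moreover have "convex hull (insert p K) \<subseteq> I" using I K by (simp add: hull_minimal)
      ultimately obtain c where c: "c > 0" "\<And>x. x \<in> convex hull (insert p K) \<Longrightarrow> c \<le> e x"
        using locally_bounded_belowE[OF e] by blast
      have "c \<le> \<mu> x" if "x \<in> K" for x
      proof -
        have "closed_segment p x \<subseteq> convex hull (insert p K)"
          using that by (intro closed_segment_subset) (auto simp: hull_inc)
        then show ?thesis unfolding \<mu>_def using c(2) by (intro cINF_greatest) auto
      qed
      then show "\<exists>c>0. \<forall>x\<in>K. c \<le> \<mu> x" using c(1) by blast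
    qed
    show "decreasing_away_from p I \<mu>"
      unfolding decreasing_away_from_def
    proof (intro ballI)
      fix x y assume "y \<in> I" "x \<in> closed_segment p y"
      moreover have "closed_segment p x \<subseteq> closed_segment p y"
        using calculation(2) by (intro closed_segment_subset) auto
      ultimately show "\<mu> y \<le> \<mu> x" unfolding \<mu>_def using bdd by (intro cINF_superset_mono) auto
    qed
    show "\<mu> x \<le> e x" if "x \<in> I" for x
      unfolding \<mu>_def using bdd[OF that] by (intro cINF_lower) auto
  qed
qed

section \<open>A bump function of finite smoothness\<close>

text \<open>
  Approximants are needed only up to a fixed order \<open>m\<close>, so a power of the positive part of \<open>(x - p) * (q - x)\<close>
  is a sufficiently smooth bump. Its derivatives all have the shape \<open>P x * max 0 (W x) ^ j\<close> with
  polynomials \<open>P\<close> and \<open>W\<close>, which makes the induction on the order immediate.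
\<close>

lemma truncated_power_derivative:
  assumes "j \<ge> 1"
  shows "((\<lambda>y::real. max 0 y ^ Suc j) has_real_derivative real (Suc j) * max 0 x ^ j) (at x)"
proof -
  consider "x > 0" | "x = 0" | "x < 0" by linarith
  then show ?thesis
  proof cases
    case 1
    have "((\<lambda>y. y ^ Suc j) has_real_derivative real (Suc j) * max 0 x ^ j) (at x)"
      using 1 DERIV_pow[of "Suc j" x] by (simp add: max_def)
    then show ?thesis
      by (rule has_field_derivative_transform_within_open[of _ _ _ "{0<..}"]) (use 1 in auto)
  next
    case 2
    have "isCont (\<lambda>y::real. max 0 y ^ j) 0" by (intro continuous_intros)
    moreover have "max 0 z ^ Suc j = max 0 z ^ j * z" for z :: real
      using assms by (cases "z \<le> 0") auto
    ultimately show ?thesis unfolding CARAT_DERIV 2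
      using assms by (intro exI[of _ "\<lambda>y. max 0 y ^ j"]) auto
  next
    case 3
    have "((\<lambda>y. 0) has_real_derivative real (Suc j) * max 0 x ^ j) (at x)"
      using 3 assms by (auto intro!: derivative_eq_intros simp: max_def)
    then show ?thesis
      by (rule has_field_derivative_transform_within_open[of _ _ _ "{..<0}"]) (use 3 in auto)
  qed
qed

lemma iter_vector_deriv_Suc:
  "iter_vector_deriv (Suc i) f = (\<lambda>x. vector_derivative (iter_vector_deriv i f) (at x))"
  by (simp add: iter_vector_deriv_def)

lemma iter_vector_deriv_Suc':
  "iter_vector_deriv (Suc i) f = iter_vector_deriv i (\<lambda>x. vector_derivative f (at x))"
  by (simp only: iter_vector_deriv_def funpow_Suc_right o_def)

lemma bump_derivative:
  fixes P W :: "real poly"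
  assumes "j \<ge> 1"
  obtains P' where "\<And>x. ((\<lambda>x. complex_of_real (poly P x * max 0 (poly W x) ^ Suc j)) has_vector_derivative
     of_real (poly P' x * max 0 (poly W x) ^ j)) (at x)"
proof
  fix x
  have "((\<lambda>x. max 0 (poly W x) ^ Suc j) has_real_derivative (real (Suc j) * max 0 (poly W x) ^ j) * poly (pderiv W) x) (at x)"
    using DERIV_chain[OF truncated_power_derivative[OF assms] poly_DERIV, of W x] by (simp add: o_def)
  from DERIV_mult[OF poly_DERIV this, of P]
  have "((\<lambda>x. poly P x * max 0 (poly W x) ^ Suc j) has_real_derivative
     poly (pderiv P) x * max 0 (poly W x) ^ Suc j + real (Suc j) * max 0 (poly W x) ^ j * poly (pderiv W) x * poly P x) (at x)" .
  moreover have "max 0 (poly W x) ^ Suc j = poly W x * max 0 (poly W x) ^ j"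
    using assms by (cases "poly W x \<le> 0") auto
  then have "poly (pderiv P) x * max 0 (poly W x) ^ Suc j + real (Suc j) * max 0 (poly W x) ^ j * poly (pderiv W) x * poly P x
     = poly (pderiv P * W + smult (real (Suc j)) (P * pderiv W)) x * max 0 (poly W x) ^ j"
    by (simp only:) (simp add: algebra_simps)
  ultimately have "((\<lambda>x. poly P x * max 0 (poly W x) ^ Suc j) has_real_derivative
     poly (pderiv P * W + smult (real (Suc j)) (P * pderiv W)) x * max 0 (poly W x) ^ j) (at x)"
    by (simp only:)
  then show "((\<lambda>x. complex_of_real (poly P x * max 0 (poly W x) ^ Suc j)) has_vector_derivative
     of_real (poly (pderiv P * W + smult (real (Suc j)) (P * pderiv W)) x * max 0 (poly W x) ^ j)) (at x)"
    by (rule has_vector_derivative_of_real)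
qed

lemma iter_vector_deriv_bump:
  assumes "i < k"
  shows "\<exists>P. iter_vector_deriv i (\<lambda>x. complex_of_real (max 0 (poly W x) ^ k)) =
     (\<lambda>x. of_real (poly P x * max 0 (poly W x) ^ (k - i)))"
  using assms
proof (induction i)
  case 0
  then show ?case by (intro exI[of _ 1]) (simp add: iter_vector_deriv_def)
next
  case (Suc i)
  then obtain P where P: "iter_vector_deriv i (\<lambda>x. complex_of_real (max 0 (poly W x) ^ k)) =
     (\<lambda>x. of_real (poly P x * max 0 (poly W x) ^ (k - i)))" by auto
  have k1: "k - Suc i \<ge> 1" using Suc.prems by simp
  obtain P' where "\<And>x. ((\<lambda>x. complex_of_real (poly P x * max 0 (poly W x) ^ Suc (k - Suc i))) has_vector_derivative
     of_real (poly P' x * max 0 (poly W x) ^ (k - Suc i))) (at x)"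
    by (rule bump_derivative[OF k1, of P W]) (rule that)
  moreover have "Suc (k - Suc i) = k - i" using Suc.prems by simp
  ultimately have "vector_derivative (\<lambda>x. complex_of_real (poly P x * max 0 (poly W x) ^ (k - i))) (at x)
     = of_real (poly P' x * max 0 (poly W x) ^ (k - Suc i))" for x
    by (metis vector_derivative_at)
  then show ?case unfolding iter_vector_deriv_Suc P by blast
qed

lemma bump_function:
  fixes p q :: real
  assumes "p < q"
  obtains w :: "real \<Rightarrow> real" and B :: real where
    "C_m_on m UNIV (\<lambda>x. complex_of_real (w x))" "continuous_on UNIV w" "\<And>x. 0 \<le> w x"
    "\<And>x. p < x \<Longrightarrow> x < q \<Longrightarrow> w x > 0" "\<And>x. x \<notin> {p..q} \<Longrightarrow> w x = 0"
    "\<And>i x. i \<le> m \<Longrightarrow> cmod (iter_vector_deriv i (\<lambda>x. complex_of_real (w x)) x) \<le> B"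
    "\<And>i x. i \<le> m \<Longrightarrow> x \<notin> {p..q} \<Longrightarrow> iter_vector_deriv i (\<lambda>x. complex_of_real (w x)) x = 0"
proof -
  define W where "W = [:- (p * q), p + q, - 1:]"
  have W: "poly W x = (x - p) * (q - x)" for x by (simp add: W_def algebra_simps)
  define w where "w = (\<lambda>x. max 0 (poly W x) ^ Suc m)"
  let ?v = "\<lambda>x. complex_of_real (w x)"
  have outside: "max 0 (poly W x) = 0" if "x \<notin> {p..q}" for x
    unfolding W using that assms by (auto simp: max_def mult_le_0_iff zero_le_mult_iff)
  have iter: "\<exists>P. iter_vector_deriv i ?v = (\<lambda>x. of_real (poly P x * max 0 (poly W x) ^ (Suc m - i)))"
    if "i \<le> m" for i
    unfolding w_def using iter_vector_deriv_bump[of i "Suc m" W] that by simp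
  have cont: "continuous_on A (iter_vector_deriv i ?v)" if "i \<le> m" for i A
    using iter[OF that] by (auto intro!: continuous_intros)
  have zero: "iter_vector_deriv i ?v x = 0" if "i \<le> m" "x \<notin> {p..q}" for i x
    using iter[OF that(1)] outside[OF that(2)] that(1) by (auto simp: Suc_diff_le)
  have diff: "iter_vector_deriv i ?v differentiable (at x)" if i: "i < m" for i x
  proof -
    obtain P where P: "iter_vector_deriv i ?v = (\<lambda>x. of_real (poly P x * max 0 (poly W x) ^ (Suc m - i)))"
      using iter[OF less_imp_le[OF i]] by (elim exE)
    have i': "Suc m - i = Suc (m - i)" "m - i \<ge> 1" using i by auto
    show ?thesis
      unfolding P i'(1) by (rule bump_derivative[OF i'(2), of P W]) (rule differentiableI_vector)
  qed
  have "bounded (\<Union>i\<in>{..m}. iter_vector_deriv i ?v ` {p..q})"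
    by (intro bounded_UN) (auto intro!: compact_imp_bounded compact_continuous_image cont)
  then obtain B where "\<forall>y\<in>(\<Union>i\<in>{..m}. iter_vector_deriv i ?v ` {p..q}). cmod y \<le> B"
    unfolding bounded_iff by (elim exE)
  then have B: "cmod (iter_vector_deriv i ?v x) \<le> B" if "i \<le> m" "x \<in> {p..q}" for i x
    using that by simp
  have "0 \<le> B"
    by (rule order.trans[OF norm_ge_zero B[of 0 p]]) (use assms in simp_all)
  show ?thesis
  proof
    show "C_m_on m UNIV ?v" unfolding C_m_on_def using diff cont by auto
    show "continuous_on UNIV w" unfolding w_def by (intro continuous_intros)
    show "0 \<le> w x" for x unfolding w_def by simp
    show "w x > 0" if "p < x" "x < q" for x
      unfolding w_def W using that by (intro zero_less_power) (simp add: max_def)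
    show "w x = 0" if "x \<notin> {p..q}" for x unfolding w_def outside[OF that] by simp
    show "cmod (iter_vector_deriv i ?v x) \<le> B" if "i \<le> m" for i x
    proof (cases "x \<in> {p..q}")
      case True
      with that show ?thesis by (rule B)
    qed (simp add: zero that \<open>0 \<le> B\<close>)
    show "iter_vector_deriv i ?v x = 0" if "i \<le> m" "x \<notin> {p..q}" for i x by (rule zero[OF that])
  qed
qed

lemma bump_primitive:
  fixes w :: "real \<Rightarrow> real"
  assumes "p < q" "continuous_on UNIV w" "\<And>x. 0 \<le> w x" "\<And>x. p < x \<Longrightarrow> x < q \<Longrightarrow> w x > 0" "\<And>x. x \<notin> {p..q} \<Longrightarrow> w x = 0"
  obtains F J where "\<And>x. (F has_real_derivative w x) (at x)" "J > 0"
    "\<And>x. x \<le> p \<Longrightarrow> F x = 0" "\<And>x. q \<le> x \<Longrightarrow> F x = J" "\<And>x. \<bar>F x\<bar> \<le> J"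
proof -
  obtain F0 where "\<And>x. (F0 has_vector_derivative w x) (at x)"
    using einterval_antiderivative[of "-\<infinity>" "\<infinity>" w] assms(2) by (auto simp: continuous_on_eq_continuous_at)
  then have F0: "(F0 has_real_derivative w x) (at x)" for x
    by (simp add: has_real_derivative_iff_has_vector_derivative)
  define F where "F = (\<lambda>x. F0 x - F0 p)"
  have F: "(F has_real_derivative w x) (at x)" for x
    unfolding F_def using DERIV_diff[OF F0 DERIV_const] by simp
  have contF: "continuous_on A F" for A
    using F by (meson DERIV_isCont continuous_at_imp_continuous_on)
  have mono: "F x \<le> F y" if "x \<le> y" for x y
    by (rule DERIV_nonneg_imp_nondecreasing[OF that]) (use F assms(3) in blast)
  have left: "F x = 0" if "x \<le> p" for x
  proof (cases "x = p")
    case False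
    have "(F has_real_derivative 0) (at y)" if "y < p" for y
      using F[of y] assms(5)[of y] that by simp
    then have "F p = F x"
      using False that by (intro DERIV_isconst_end[of x p F] contF) auto
    then show ?thesis by (simp add: F_def)
  qed (simp add: F_def)
  have right: "F x = F q" if "q \<le> x" for x
  proof (cases "x = q")
    case False
    have "(F has_real_derivative 0) (at y)" if "q < y" for y
      using F[of y] assms(5)[of y] that by simp
    then show ?thesis
      using False that by (intro DERIV_isconst_end[of q x F] contF) auto
  qed simp
  have "F p < F q"
    by (rule DERIV_pos_imp_increasing_open[OF assms(1) _ contF]) (use F assms(4) in blast)
  then have pos: "0 < F q" by (simp add: F_def)
  show ?thesis
  proof
    show "\<bar>F x\<bar> \<le> F q" for x
    proof -
      have "0 \<le> F x" using mono[of "min x p" x] left[of "min x p"] by simp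
      moreover have "F x \<le> F q" using mono[of x "max x q"] right[of "max x q"] by simp
      ultimately show ?thesis by simp
    qed
  qed (rule F pos left right; assumption)+
qed

section \<open>Raising the order of approximation by integration\<close>

definition jet_dense :: "nat \<Rightarrow> real set \<Rightarrow> complex set \<Rightarrow> bool" where
  "jet_dense m I U \<longleftrightarrow>
     (\<forall>f e. C_m_on m I f \<longrightarrow> locally_bounded_below I e \<longrightarrow>
       (\<exists>g. g holomorphic_on U \<and>
          (\<forall>x\<in>I. \<forall>i\<le>m. cmod (iter_vector_deriv i f x - (deriv ^^ i) g (of_real x)) < e x)))"

lemma jet_denseE:
  assumes "jet_dense m I U" "C_m_on m I f" "locally_bounded_below I e"
  obtains g where "g holomorphic_on U"
    "\<And>x i. x \<in> I \<Longrightarrow> i \<le> m \<Longrightarrow> cmod (iter_vector_deriv i f x - (deriv ^^ i) g (of_real x)) < e x"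
proof -
  have "\<exists>g. g holomorphic_on U \<and>
     (\<forall>x\<in>I. \<forall>i\<le>m. cmod (iter_vector_deriv i f x - (deriv ^^ i) g (of_real x)) < e x)"
    using assms unfolding jet_dense_def by simp
  then show ?thesis using that by auto
qed

text \<open>
  Approximation with the tolerance \<open>\<theta> * \<mu> x / (4 * (1 + x\<^sup>2))\<close>, the one that
  makes primitives of the error settle within \<open>\<theta> * \<mu>\<close> of constants. For the derivatives the cruder bound
  \<open>\<theta> * \<mu>\<close> suffices.
\<close>

lemma jet_dense_dominated:
  assumes jd: "jet_dense m I U" and f: "C_m_on m I f" and \<mu>: "locally_bounded_below I \<mu>" and "\<theta> > 0"
  obtains g where "g holomorphic_on U"
    "\<And>x. x \<in> I \<Longrightarrow> cmod (f x - g (of_real x)) \<le> \<theta> * \<mu> x / (4 * (1 + x\<^sup>2))"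
    "\<And>x i. x \<in> I \<Longrightarrow> i \<le> m \<Longrightarrow> cmod (iter_vector_deriv i f x - (deriv ^^ i) g (of_real x)) \<le> \<theta> * \<mu> x"
proof -
  have pos: "0 < 4 * (1 + x\<^sup>2)" for x :: real
    by (intro mult_pos_pos add_pos_nonneg) auto
  have "locally_bounded_below I (\<lambda>x::real. \<theta> / (4 * (1 + x\<^sup>2)))"
  proof (rule locally_bounded_below_continuous)
    have "4 * (1 + x\<^sup>2) \<noteq> 0" for x :: real using pos[of x] by linarith
    then show "continuous_on I (\<lambda>x::real. \<theta> / (4 * (1 + x\<^sup>2)))"
      by (intro continuous_intros) blast
    show "0 < \<theta> / (4 * (1 + x\<^sup>2))" for x by (rule divide_pos_pos[OF \<open>\<theta> > 0\<close> pos])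
  qed
  from locally_bounded_below_mult[OF this \<mu>]
  obtain g where g: "g holomorphic_on U"
    "\<And>x i. x \<in> I \<Longrightarrow> i \<le> m \<Longrightarrow> cmod (iter_vector_deriv i f x - (deriv ^^ i) g (of_real x)) < \<theta> / (4 * (1 + x\<^sup>2)) * \<mu> x"
    by (rule jet_denseE[OF jd f]) (assumption | rule that)+
  show ?thesis
  proof
    show "g holomorphic_on U" by (rule g(1))
    show "cmod (f x - g (of_real x)) \<le> \<theta> * \<mu> x / (4 * (1 + x\<^sup>2))" if "x \<in> I" for x
      using g(2)[OF that, of 0] by (simp add: iter_vector_deriv_def)
    show "cmod (iter_vector_deriv i f x - (deriv ^^ i) g (of_real x)) \<le> \<theta> * \<mu> x" if "x \<in> I" "i \<le> m" for x i
    proof -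
      have "\<theta> / (4 * (1 + x\<^sup>2)) \<le> \<theta> / 1"
        using \<open>\<theta> > 0\<close> by (intro frac_le) (auto intro: order.trans[OF _ add_increasing2])
      then have "\<theta> / (4 * (1 + x\<^sup>2)) * \<mu> x \<le> \<theta> / 1 * \<mu> x"
        using locally_bounded_below_pos[OF \<mu> that(1)] by (intro mult_right_mono) auto
      then show ?thesis using g(2)[OF that] by simp
    qed
  qed
qed

lemma C_m_on_subset:
  assumes "C_m_on m J f" "I \<subseteq> J"
  shows "C_m_on m I f"
  using assms continuous_on_subset unfolding C_m_on_def by blast

text \<open>
  Let \<open>u\<close> approximate a bump supported in \<open>[p, q]\<close>, and let \<open>V\<close> be a primitive of \<open>u\<close>. The difference of \<open>V\<close> and
  the primitive \<open>F\<close> of the bump settles within \<open>\<theta> * \<mu>\<close> of constants, while \<open>F\<close> jumps from \<open>0\<close> to \<open>J\<close>; if \<open>\<theta>\<close> is small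
  compared with \<open>J\<close>, then \<open>V\<close> keeps a nonzero jump. On the compact set \<open>[p, q]\<close>, where the bump
  is not small, \<open>\<mu>\<close> has a positive lower bound, which is absorbed into \<open>C\<close>.
\<close>

lemma transition_function:
  assumes jd: "jet_dense m (einterval a b) U"
    and \<mu>: "locally_bounded_below (einterval a b) \<mu>" "decreasing_away_from p (einterval a b) \<mu>"
    and p: "p \<in> einterval a b" and U: "open U" "starlike U" "complex_of_real ` einterval a b \<subseteq> U"
  obtains u V c c' C where "u holomorphic_on U" "\<And>z. z \<in> U \<Longrightarrow> (V has_field_derivative u z) (at z)"
    "c \<noteq> c'" "C \<ge> 0" "settles (einterval a b) p (\<lambda>x. C * \<mu> x) (\<lambda>x. V (of_real x)) c c'"
    "\<And>x i. x \<in> einterval a b \<Longrightarrow> i \<le> m \<Longrightarrow> cmod ((deriv ^^ i) u (of_real x)) \<le> C * \<mu> x"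
proof -
  let ?I = "einterval a b"
  have \<mu>pos: "\<mu> x > 0" if "x \<in> ?I" for x by (rule locally_bounded_below_pos[OF \<mu>(1) that])
  obtain r where r: "r > 0" "cball p r \<subseteq> ?I"
    using open_contains_cball[of ?I] p by auto
  define q where "q = p + r"
  have pq: "p < q" "{p..q} \<subseteq> ?I"
    using r(1) order.trans[OF _ r(2), of "{p..p + r}"] by (auto simp: q_def cball_eq_atLeastAtMost)
  obtain \<kappa> where \<kappa>: "\<kappa> > 0" "\<And>x. x \<in> {p..q} \<Longrightarrow> \<kappa> \<le> \<mu> x"
    by (rule locally_bounded_belowE[OF \<mu>(1) compact_Icc pq(2)]) (assumption | rule that)+
  obtain w B where w: "C_m_on m UNIV (\<lambda>x. complex_of_real (w x))" "continuous_on UNIV w" "\<And>x. 0 \<le> w x"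
    "\<And>x. p < x \<Longrightarrow> x < q \<Longrightarrow> w x > 0" "\<And>x. x \<notin> {p..q} \<Longrightarrow> w x = 0"
    "\<And>i x. i \<le> m \<Longrightarrow> cmod (iter_vector_deriv i (\<lambda>x. complex_of_real (w x)) x) \<le> B"
    "\<And>i x. i \<le> m \<Longrightarrow> x \<notin> {p..q} \<Longrightarrow> iter_vector_deriv i (\<lambda>x. complex_of_real (w x)) x = 0"
    by (rule bump_function[OF pq(1), of m]) (assumption | rule that)+
  obtain F J where F: "\<And>x. (F has_real_derivative w x) (at x)" "J > 0"
    "\<And>x. x \<le> p \<Longrightarrow> F x = 0" "\<And>x. q \<le> x \<Longrightarrow> F x = J" "\<And>x. \<bar>F x\<bar> \<le> J"
    by (rule bump_primitive[OF pq(1) w(2-5)]) (assumption | rule that)+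
  have B0: "0 \<le> B" by (rule order.trans[OF norm_ge_zero w(6)[of 0 p]]) simp
  \<comment> \<open>The constants at which the difference settles then differ by at most \<open>J / 2\<close>.\<close>
  define \<theta> where "\<theta> = J / (4 * \<mu> p)"
  have \<theta>: "\<theta> > 0" using F(2) \<mu>pos[OF p] by (simp add: \<theta>_def)
  obtain u where u: "u holomorphic_on U"
    "\<And>x. x \<in> ?I \<Longrightarrow> cmod (of_real (w x) - u (of_real x)) \<le> \<theta> * \<mu> x / (4 * (1 + x\<^sup>2))"
    "\<And>x i. x \<in> ?I \<Longrightarrow> i \<le> m \<Longrightarrow> cmod (iter_vector_deriv i (\<lambda>x. complex_of_real (w x)) x - (deriv ^^ i) u (of_real x)) \<le> \<theta> * \<mu> x"
    by (rule jet_dense_dominated[OF jd C_m_on_subset[OF w(1) subset_UNIV] \<mu>(1) \<theta>]) (assumption | rule that)+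
  obtain V where "\<forall>z\<in>U. (V has_field_derivative u z) (at z)"
    using holomorphic_starlike_primitive[OF holomorphic_on_imp_continuous_on[OF u(1)] U(2,1) finite.emptyI]
      holomorphic_on_imp_differentiable_at[OF u(1) U(1)] by auto
  then have V: "(V has_field_derivative u z) (at z)" if "z \<in> U" for z using that by blast
  have realU: "of_real x \<in> U" if "x \<in> ?I" for x using U(3) that by blast
  define E where "E = (\<lambda>x. V (of_real x) - of_real (F x))"
  have dE: "(E has_vector_derivative (u (of_real x) - of_real (w x))) (at x)" if "x \<in> ?I" for x
    unfolding E_def
    by (intro has_vector_derivative_diff has_vector_derivative_real_field V realU that has_vector_derivative_of_real F)
  have dec: "decreasing_away_from p ?I (\<lambda>x. \<theta> * \<mu> x)"
    using \<mu>(2) \<theta> unfolding decreasing_away_from_def by (simp add: mult_left_mono)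
  have nonneg: "0 \<le> \<theta> * \<mu> x" if "x \<in> ?I" for x using \<theta> \<mu>pos[OF that] by simp
  have bound: "cmod (u (of_real x) - of_real (w x)) \<le> \<theta> * \<mu> x / (4 * (1 + x\<^sup>2))" if "x \<in> ?I" for x
    using u(2)[OF that] by (simp add: norm_minus_commute)
  obtain c c1 where c: "settles ?I p (\<lambda>x. \<theta> * \<mu> x) E c c1"
    by (rule settles_if_derivative_small[OF p dec nonneg dE bound]) (assumption | rule that)+
  define C where "C = \<theta> + (B + 2 * J) / \<kappa>"
  have quot: "A \<le> (B + 2 * J) / \<kappa> * \<mu> x" if "A \<le> B + 2 * J" "x \<in> {p..q}" for A x
  proof -
    have "(B + 2 * J) / \<kappa> * \<kappa> \<le> (B + 2 * J) / \<kappa> * \<mu> x"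
      using \<kappa>(1) \<kappa>(2)[OF that(2)] B0 F(2) by (intro mult_left_mono) auto
    then show ?thesis using that(1) \<kappa>(1) by simp
  qed
  have quot0: "0 \<le> (B + 2 * J) / \<kappa> * \<mu> x" if "x \<in> ?I" for x
    using \<kappa>(1) \<mu>pos[OF that] B0 F(2) by simp
  have Csplit: "C * \<mu> x = \<theta> * \<mu> x + (B + 2 * J) / \<kappa> * \<mu> x" for x
    by (simp add: C_def distrib_right)
  show ?thesis
  proof
    show "u holomorphic_on U" by (rule u(1))
    show "(V has_field_derivative u z) (at z)" if "z \<in> U" for z by (rule V[OF that])
    show "C \<ge> 0" unfolding C_def using \<theta> \<kappa>(1) B0 F(2) by simp
    show "c \<noteq> c1 + of_real J"
    proof
      assume "c = c1 + of_real J"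
      then have "cmod (c1 - c) = J" using F(2) by simp
      moreover have "2 * (\<theta> * \<mu> p) = J / 2" using \<mu>pos[OF p] by (simp add: \<theta>_def)
      ultimately show False using settles_jump[OF c p] F(2) by simp
    qed
    show "settles ?I p (\<lambda>x. C * \<mu> x) (\<lambda>x. V (of_real x)) c (c1 + of_real J)"
      unfolding settles_def
    proof (intro conjI ballI impI)
      fix x assume x: "x \<in> ?I" "x \<le> p"
      then have "cmod (V (of_real x) - c) \<le> \<theta> * \<mu> x"
        using c F(3) unfolding settles_def E_def by auto
      then show "cmod (V (of_real x) - c) \<le> C * \<mu> x"
        unfolding Csplit using quot0[OF x(1)] by linarith
    next
      fix x assume x: "x \<in> ?I" "p \<le> x"
      have 1: "cmod (E x - c1) \<le> \<theta> * \<mu> x" using c x unfolding settles_def by blast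
      have 2: "\<bar>F x - J\<bar> \<le> (B + 2 * J) / \<kappa> * \<mu> x"
      proof (cases "x \<le> q")
        case True
        then show ?thesis using quot[of "\<bar>F x - J\<bar>" x] F(5)[of x] F(2) B0 x by auto
      next
        case False
        then have "\<bar>F x - J\<bar> = 0" using F(4)[of x] by simp
        then show ?thesis using quot0[OF x(1)] by linarith
      qed
      have "V (of_real x) - (c1 + of_real J) = (E x - c1) + of_real (F x - J)"
        by (simp add: E_def)
      then show "cmod (V (of_real x) - (c1 + of_real J)) \<le> C * \<mu> x"
        unfolding Csplit using norm_triangle_ineq[of "E x - c1" "of_real (F x - J)"] 1 2
        by (simp only: norm_of_real)
    qed
    show "cmod ((deriv ^^ i) u (of_real x)) \<le> C * \<mu> x" if x: "x \<in> ?I" and i: "i \<le> m" for x i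
    proof -
      have "cmod (iter_vector_deriv i (\<lambda>x. complex_of_real (w x)) x) \<le> (B + 2 * J) / \<kappa> * \<mu> x"
      proof (cases "x \<in> {p..q}")
        case True
        then show ?thesis using w(6)[OF i, of x] F(2) by (intro quot) auto
      next
        case False
        show ?thesis unfolding w(7)[OF i False] norm_zero by (rule quot0[OF x])
      qed
      moreover have "cmod ((deriv ^^ i) u (of_real x)) \<le>
          cmod (iter_vector_deriv i (\<lambda>x. complex_of_real (w x)) x) +
          cmod (iter_vector_deriv i (\<lambda>x. complex_of_real (w x)) x - (deriv ^^ i) u (of_real x))"
        by (subst norm_minus_commute) (rule norm_triangle_sub)
      ultimately show ?thesis unfolding Csplit using u(3)[OF x i] by linarith
    qed
  qed
qed

text \<open>
  With \<open>H\<close> a primitive of the approximant \<open>h\<close> of \<open>f'\<close>, the error \<open>f - H\<close> settles at constants \<open>d\<close> and \<open>d'\<close>, whereas \<open>V\<close>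
  settles at \<open>c \<noteq> c'\<close>. The affine function of \<open>V\<close> with the value \<open>d\<close> at \<open>c\<close> and \<open>d'\<close> at \<open>c'\<close> cancels both
  constants. Its slope \<open>\<kappa>\<close> is of the order of \<open>\<theta>\<close>, because \<open>d' - d\<close> is, while \<open>V\<close> and \<open>C\<close> are chosen before
  \<open>\<theta>\<close>; hence the correction is small together with its derivatives.
\<close>

lemma jet_dense_Suc:
  assumes jd: "jet_dense m (einterval a b) U"
    and p: "p \<in> einterval a b" and U: "open U" "starlike U" "complex_of_real ` einterval a b \<subseteq> U"
  shows "jet_dense (Suc m) (einterval a b) U"
  unfolding jet_dense_def
proof (intro allI impI)
  fix f :: "real \<Rightarrow> complex" and e :: "real \<Rightarrow> real"
  let ?I = "einterval a b"
  assume f: "C_m_on (Suc m) ?I f" and e: "locally_bounded_below ?I e"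
  define f' where "f' = (\<lambda>x. vector_derivative f (at x))"
  have iter: "iter_vector_deriv (Suc i) f = iter_vector_deriv i f'" for i
    unfolding f'_def by (rule iter_vector_deriv_Suc')
  have f': "C_m_on m ?I f'"
    using f unfolding C_m_on_def by (simp flip: iter)
  have df: "(f has_vector_derivative f' x) (at x)" if "x \<in> ?I" for x
  proof -
    have "iter_vector_deriv 0 f differentiable (at x)" using f that unfolding C_m_on_def by blast
    then have "f differentiable (at x)" by (simp add: iter_vector_deriv_def)
    then show ?thesis unfolding f'_def by (simp add: vector_derivative_works)
  qed
  obtain \<mu> where \<mu>: "locally_bounded_below ?I \<mu>" "decreasing_away_from p ?I \<mu>" "\<And>x. x \<in> ?I \<Longrightarrow> \<mu> x \<le> e x"
    by (rule decreasing_minorant[OF e convex_einterval p]) (assumption | rule that)+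
  have \<mu>pos: "\<mu> x > 0" if "x \<in> ?I" for x by (rule locally_bounded_below_pos[OF \<mu>(1) that])
  obtain u V c c' C where u: "u holomorphic_on U" "\<And>z. z \<in> U \<Longrightarrow> (V has_field_derivative u z) (at z)"
    "c \<noteq> c'" "C \<ge> 0" "settles ?I p (\<lambda>x. C * \<mu> x) (\<lambda>x. V (of_real x)) c c'"
    "\<And>x i. x \<in> ?I \<Longrightarrow> i \<le> m \<Longrightarrow> cmod ((deriv ^^ i) u (of_real x)) \<le> C * \<mu> x"
    by (rule transition_function[OF jd \<mu>(1,2) p U]) (assumption | rule that)+
  \<comment> \<open>\<open>\<theta> * K\<close> will bound \<open>\<bar>\<kappa>\<bar> * C\<close>; the choice of \<open>\<theta>\<close> makes the total error at most \<open>\<mu> / 2\<close>.\<close>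
  define K where "K = 2 * \<mu> p * C / cmod (c' - c)"
  have K: "K \<ge> 0" using \<mu>pos[OF p] u(4) by (simp add: K_def)
  define \<theta> where "\<theta> = 1 / (2 * (1 + K))"
  have \<theta>: "\<theta> > 0" "\<theta> * (1 + K) = 1 / 2" using K by (auto simp: \<theta>_def field_simps)
  obtain h where h: "h holomorphic_on U"
    "\<And>x. x \<in> ?I \<Longrightarrow> cmod (f' x - h (of_real x)) \<le> \<theta> * \<mu> x / (4 * (1 + x\<^sup>2))"
    "\<And>x i. x \<in> ?I \<Longrightarrow> i \<le> m \<Longrightarrow> cmod (iter_vector_deriv i f' x - (deriv ^^ i) h (of_real x)) \<le> \<theta> * \<mu> x"
    by (rule jet_dense_dominated[OF jd f' \<mu>(1) \<theta>(1)]) (assumption | rule that)+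
  obtain H where "\<forall>z\<in>U. (H has_field_derivative h z) (at z)"
    using holomorphic_starlike_primitive[OF holomorphic_on_imp_continuous_on[OF h(1)] U(2,1) finite.emptyI]
      holomorphic_on_imp_differentiable_at[OF h(1) U(1)] by auto
  then have H: "(H has_field_derivative h z) (at z)" if "z \<in> U" for z using that by blast
  have realU: "of_real x \<in> U" if "x \<in> ?I" for x using U(3) that by blast
  define E where "E = (\<lambda>x. f x - H (of_real x))"
  have dE: "(E has_vector_derivative (f' x - h (of_real x))) (at x)" if "x \<in> ?I" for x
    unfolding E_def
    by (intro has_vector_derivative_diff has_vector_derivative_real_field H realU that df)
  have dec: "decreasing_away_from p ?I (\<lambda>x. \<theta> * \<mu> x)"
    using \<mu>(2) \<theta> unfolding decreasing_away_from_def by (simp add: mult_left_mono)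
  have nonneg: "0 \<le> \<theta> * \<mu> x" if "x \<in> ?I" for x using \<theta> \<mu>pos[OF that] by simp
  obtain d d' where d: "settles ?I p (\<lambda>x. \<theta> * \<mu> x) E d d'"
    by (rule settles_if_derivative_small[OF p dec nonneg dE h(2)]) (assumption | rule that)+
  define \<kappa> where "\<kappa> = (d' - d) / (c' - c)"
  have "cmod \<kappa> * C \<le> 2 * (\<theta> * \<mu> p) / cmod (c' - c) * C"
    unfolding \<kappa>_def norm_divide using settles_jump[OF d p] u(4)
    by (intro mult_right_mono divide_right_mono) auto
  then have \<kappa>C: "cmod \<kappa> * C \<le> \<theta> * K" by (simp add: K_def mult_ac)
  have half: "A < e x" if "x \<in> ?I" "A \<le> \<theta> * \<mu> x + cmod \<kappa> * (C * \<mu> x)" for A x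
  proof -
    have "cmod \<kappa> * C * \<mu> x \<le> \<theta> * K * \<mu> x"
      using \<kappa>C \<mu>pos[OF that(1)] by (intro mult_right_mono) auto
    then have "A \<le> \<theta> * (1 + K) * \<mu> x" using that(2) by (simp add: algebra_simps)
    then show ?thesis using \<mu>(3)[OF that(1)] \<mu>pos[OF that(1)] unfolding \<theta>(2) by simp
  qed
  define g where "g = (\<lambda>z. H z + (d + \<kappa> * (V z - c)))"
  have dg: "(g has_field_derivative h z + \<kappa> * u z) (at z)" if "z \<in> U" for z
    unfolding g_def using H[OF that] u(2)[OF that] by (auto intro!: derivative_eq_intros)
  have holg: "g holomorphic_on U" using dg U(1) by (auto simp: holomorphic_on_open)
  have "cmod (iter_vector_deriv i f x - (deriv ^^ i) g (of_real x)) < e x"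
    if x: "x \<in> ?I" and i: "i \<le> Suc m" for x i
  proof (cases i)
    case 0
    have "cmod (f x - g (of_real x)) \<le> \<theta> * \<mu> x + cmod \<kappa> * (C * \<mu> x)"
    proof (cases "x \<le> p")
      case True
      have "f x - g (of_real x) = (E x - d) - \<kappa> * (V (of_real x) - c)"
        by (simp add: E_def g_def)
      moreover have "cmod (E x - d) \<le> \<theta> * \<mu> x" "cmod (V (of_real x) - c) \<le> C * \<mu> x"
        using d u(5) x True unfolding settles_def by auto
      ultimately show ?thesis
        using norm_triangle_ineq4[of "E x - d" "\<kappa> * (V (of_real x) - c)"]
          mult_left_mono[OF _ norm_ge_zero[of \<kappa>], of "cmod (V (of_real x) - c)" "C * \<mu> x"]
        by (simp add: norm_mult)
    next
      case False
      have "\<kappa> * (c' - c) = d' - d" using u(3) by (simp add: \<kappa>_def)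
      then have "f x - g (of_real x) = (E x - d') - \<kappa> * (V (of_real x) - c')"
        by (simp add: E_def g_def algebra_simps)
      moreover have "cmod (E x - d') \<le> \<theta> * \<mu> x" "cmod (V (of_real x) - c') \<le> C * \<mu> x"
        using d u(5) x False unfolding settles_def by auto
      ultimately show ?thesis
        using norm_triangle_ineq4[of "E x - d'" "\<kappa> * (V (of_real x) - c')"]
          mult_left_mono[OF _ norm_ge_zero[of \<kappa>], of "cmod (V (of_real x) - c')" "C * \<mu> x"]
        by (simp add: norm_mult)
    qed
    then show ?thesis using half[OF x] 0 by (simp add: iter_vector_deriv_def)
  next
    case (Suc j)
    then have j: "j \<le> m" using i by simp
    have "(deriv ^^ i) g (of_real x) = (deriv ^^ j) (deriv g) (of_real x)"
      unfolding Suc funpow_Suc_right by simp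
    also have "\<dots> = (deriv ^^ j) (\<lambda>z. h z + \<kappa> * u z) (of_real x)"
      by (rule higher_deriv_transform_within_open[OF _ _ U(1) realU[OF x]])
         (use dg U(1) holg in \<open>auto intro!: holomorphic_intros h(1) u(1) DERIV_imp_deriv\<close>)
    also have "\<dots> = (deriv ^^ j) h (of_real x) + (deriv ^^ j) (\<lambda>z. \<kappa> * u z) (of_real x)"
      by (rule higher_deriv_add[OF h(1) _ U(1) realU[OF x]]) (intro holomorphic_intros u(1))
    also have "(deriv ^^ j) (\<lambda>z. \<kappa> * u z) (of_real x) = \<kappa> * (deriv ^^ j) u (of_real x)"
      by (rule higher_deriv_cmult[OF u(1) realU[OF x] U(1)])
    finally have "iter_vector_deriv i f x - (deriv ^^ i) g (of_real x) =
        (iter_vector_deriv j f' x - (deriv ^^ j) h (of_real x)) - \<kappa> * (deriv ^^ j) u (of_real x)"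
      unfolding Suc iter by simp
    then have "cmod (iter_vector_deriv i f x - (deriv ^^ i) g (of_real x)) \<le> \<theta> * \<mu> x + cmod \<kappa> * (C * \<mu> x)"
      using norm_triangle_ineq4[of "iter_vector_deriv j f' x - (deriv ^^ j) h (of_real x)" "\<kappa> * (deriv ^^ j) u (of_real x)"]
        h(3)[OF x j] mult_left_mono[OF u(6)[OF x j] norm_ge_zero[of \<kappa>]]
      by (simp add: norm_mult)
    then show ?thesis by (rule half[OF x])
  qed
  then show "\<exists>g. g holomorphic_on U \<and>
          (\<forall>x\<in>?I. \<forall>i\<le>Suc m. cmod (iter_vector_deriv i f x - (deriv ^^ i) g (of_real x)) < e x)"
    using holg by blast
qed

section \<open>The slit plane\<close>

definition end_term :: "ereal \<Rightarrow> complex \<Rightarrow> complex" where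
  "end_term c z = (if \<bar>c\<bar> = \<infinity> then 0 else 1 / (z - of_real (real_of_ereal c)) ^ 2)"

abbreviation (input) slit_plane :: "ereal \<Rightarrow> ereal \<Rightarrow> complex set" where
  "slit_plane a b \<equiv> UNIV - complex_of_real ` (UNIV - einterval a b)"

lemma open_slit_plane: "open (slit_plane a b)"
proof -
  have "closed (complex_of_real ` (UNIV - einterval a b))"
    by (intro closed_injective_linear_image bounded_linear.linear[OF bounded_linear_of_real])
       (auto simp: closed_Diff inj_on_def)
  then show ?thesis by (simp add: open_Diff)
qed

lemma of_real_in_slit_plane: "complex_of_real x \<in> slit_plane a b \<longleftrightarrow> x \<in> einterval a b"
  by auto

text \<open>
  A segment from a point of the interval to a nonreal point meets the real axis only at its starting
  point, and a segment to another point of the interval stays in the interval.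
\<close>

lemma starlike_slit_plane:
  assumes "p \<in> einterval a b"
  shows "starlike (slit_plane a b)"
  unfolding starlike_def
proof (intro bexI ballI subsetI)
  show "complex_of_real p \<in> slit_plane a b" by (rule iffD2[OF of_real_in_slit_plane assms])
  fix z w assume z: "z \<in> slit_plane a b" and "w \<in> closed_segment (complex_of_real p) z"
  then obtain t where t: "0 \<le> t" "t \<le> 1" "w = (1 - t) *\<^sub>R of_real p + t *\<^sub>R z"
    unfolding closed_segment_def by blast
  have "w \<noteq> of_real r" if r: "r \<notin> einterval a b" for r
  proof
    assume w: "w = of_real r"
    have "t * Im z = 0" using arg_cong[OF w, of Im] by (simp add: t(3))
    then consider "t = 0" | "Im z = 0" by auto
    then show False
    proof cases
      case 1
      then have "r = p" using w t(3) by simp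
      then show False using r assms by simp
    next
      case 2
      then have z': "z = of_real (Re z)" by (simp add: complex_eq_iff)
      then have "Re z \<in> einterval a b" using z of_real_in_slit_plane[of "Re z"] by simp
      moreover have "r = (1 - t) *\<^sub>R p + t *\<^sub>R Re z" using arg_cong[OF w, of Re] by (simp add: t(3))
      ultimately have "r \<in> einterval a b"
        using convexD_alt[OF convex_einterval assms] t(1,2) by simp
      then show False using r by simp
    qed
  qed
  then show "w \<in> slit_plane a b" by auto
qed

lemma end_term_holomorphic:
  assumes "\<bar>c\<bar> \<noteq> \<infinity> \<Longrightarrow> complex_of_real (real_of_ereal c) \<notin> U"
  shows "end_term c holomorphic_on U"
proof (cases "\<bar>c\<bar> = \<infinity>")
  case False
  then have "z - of_real (real_of_ereal c) \<noteq> 0" if "z \<in> U" for z using assms that by auto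
  then show ?thesis unfolding end_term_def using False by (auto intro!: holomorphic_intros)
qed (simp add: end_term_def[abs_def])

lemma end_term_of_real:
  "end_term c (of_real x) = of_real (if \<bar>c\<bar> = \<infinity> then 0 else 1 / (x - real_of_ereal c)\<^sup>2)"
  by (simp add: end_term_def)

lemma far_from_end:
  fixes x y t :: real
  assumes "x \<noteq> y" "1 / (x - y)\<^sup>2 \<le> t"
  shows "1 / (1 + t) \<le> \<bar>x - y\<bar>"
proof (rule ccontr)
  assume "\<not> ?thesis"
  moreover have "0 \<le> t" using assms(2) by (rule order.trans[rotated]) simp
  ultimately have "\<bar>x - y\<bar> * (1 + t) < 1" by (simp add: field_simps)
  then have "(\<bar>x - y\<bar> * (1 + t))\<^sup>2 < 1" using \<open>0 \<le> t\<close> by (simp add: power_less_one_iff)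
  moreover have "t \<le> (1 + t)\<^sup>2" using \<open>0 \<le> t\<close> by (simp add: power2_eq_square algebra_simps)
  moreover have "1 \<le> t * (x - y)\<^sup>2" using assms by (simp add: field_simps)
  moreover have "t * (x - y)\<^sup>2 \<le> (1 + t)\<^sup>2 * (x - y)\<^sup>2" using calculation(2) by (intro mult_right_mono) auto
  ultimately show False by (simp add: power_mult_distrib mult.commute)
qed

text \<open>
  Each of the three nonnegative summands of \<open>\<rho>\<close> is at most \<open>t\<close> on the sublevel set: the square bounds \<open>\<bar>x\<bar>\<close>, and
  the other two keep \<open>x\<close> away from the finite end points.
\<close>

lemma real_exhaustion_slit_plane:
  assumes "a < b"
  defines "\<rho> \<equiv> \<lambda>x. x\<^sup>2 + (if \<bar>a\<bar> = \<infinity> then 0 else 1 / (x - real_of_ereal a)\<^sup>2) + (if \<bar>b\<bar> = \<infinity> then 0 else 1 / (x - real_of_ereal b)\<^sup>2)"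
  shows "real_exhaustion (einterval a b) (slit_plane a b) (\<lambda>z. z\<^sup>2 + end_term a z + end_term b z) \<rho>"
proof
  let ?I = "einterval a b"
  show "open (slit_plane a b)" by (rule open_slit_plane)
  show "complex_of_real x \<in> slit_plane a b" if "x \<in> ?I" for x by (rule iffD2[OF of_real_in_slit_plane that])
  have notin: "complex_of_real (real_of_ereal c) \<notin> slit_plane a b" if "c = a \<or> c = b" "\<bar>c\<bar> \<noteq> \<infinity>" for c
  proof -
    have "real_of_ereal c \<notin> ?I" using that by (auto simp: einterval_iff ereal_real)
    then show ?thesis unfolding of_real_in_slit_plane .
  qed
  show "(\<lambda>z. z\<^sup>2 + end_term a z + end_term b z) holomorphic_on slit_plane a b"
    by (intro holomorphic_intros end_term_holomorphic notin) auto
  show "(complex_of_real x)\<^sup>2 + end_term a (of_real x) + end_term b (of_real x) = of_real (\<rho> x)" for x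
    unfolding \<rho>_def end_term_of_real by (simp only: of_real_add of_real_power)
  show rho_nonneg: "0 \<le> \<rho> x" for x unfolding \<rho>_def by auto
  fix t :: real
  define l where "l = (if \<bar>a\<bar> = \<infinity> then - (1 + t) else real_of_ereal a + 1 / (1 + t))"
  define u where "u = (if \<bar>b\<bar> = \<infinity> then 1 + t else real_of_ereal b - 1 / (1 + t))"
  have sub: "{x \<in> ?I. \<rho> x \<le> t} \<subseteq> {l..u}"
  proof
    fix x assume "x \<in> {x \<in> ?I. \<rho> x \<le> t}"
    then have x: "a < ereal x" "ereal x < b" "\<rho> x \<le> t" by (auto simp: einterval_iff)
    have sq: "x\<^sup>2 \<le> t"
      by (rule order.trans[OF _ x(3)]) (simp add: \<rho>_def)
    have absx: "\<bar>x\<bar> \<le> 1 + t"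
    proof (rule power2_le_imp_le)
      show "0 \<le> 1 + t" using order.trans[OF zero_le_power2 sq] by simp
      have "0 \<le> t" using order.trans[OF zero_le_power2 sq] .
      have "t \<le> (1 + t)\<^sup>2"
        using zero_le_square[of t] \<open>0 \<le> t\<close> unfolding power2_eq_square distrib_left distrib_right by linarith
      then show "\<bar>x\<bar>\<^sup>2 \<le> (1 + t)\<^sup>2" using sq by simp
    qed
    have "l \<le> x"
    proof (cases "\<bar>a\<bar> = \<infinity>")
      case False
      then obtain r where r: "a = ereal r" by auto
      have "1 / (x - r)\<^sup>2 \<le> t"
        by (rule order.trans[OF _ x(3)]) (simp add: \<rho>_def r)
      then show ?thesis using far_from_end[of x r t] x(1) unfolding l_def r by auto
    qed (use absx in \<open>auto simp: l_def\<close>)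
    moreover have "x \<le> u"
    proof (cases "\<bar>b\<bar> = \<infinity>")
      case False
      then obtain r where r: "b = ereal r" by auto
      have "1 / (x - r)\<^sup>2 \<le> t"
        by (rule order.trans[OF _ x(3)]) (simp add: \<rho>_def r)
      then show ?thesis using far_from_end[of x r t] x(2) unfolding u_def r by auto
    qed (use absx in \<open>auto simp: u_def\<close>)
    ultimately show "x \<in> {l..u}" by simp
  qed
  show "\<exists>C. compact C \<and> C \<subseteq> ?I \<and> {x \<in> ?I. \<rho> x \<le> t} \<subseteq> C"
  proof (cases "t \<ge> 0")
    case True
    then have "1 / (1 + t) > 0" by simp
    then have "a < ereal l" "ereal u < b"
      using assms(1) unfolding l_def u_def by (cases a; cases b; auto)+
    then have "{l..u} \<subseteq> ?I"
      using less_le_trans[of a "ereal l"] le_less_trans[of _ "ereal u" b]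
      unfolding einterval_def by (auto simp: subset_iff)
    then show ?thesis using sub compact_Icc by blast
  next
    case False
    have "\<not> \<rho> x \<le> t" for x using rho_nonneg[of x] False by linarith
    then show ?thesis by (intro exI[of _ "{}"]) simp
  qed
qed

lemma jet_dense_slit_plane:
  assumes "p \<in> einterval a b"
  shows "jet_dense m (einterval a b) (slit_plane a b)"
proof (induction m)
  case 0
  have "a < b" using assms less_trans unfolding einterval_iff by blast
  then interpret real_exhaustion "einterval a b" "slit_plane a b" "\<lambda>z. z\<^sup>2 + end_term a z + end_term b z"
    "\<lambda>x. x\<^sup>2 + (if \<bar>a\<bar> = \<infinity> then 0 else 1 / (x - real_of_ereal a)\<^sup>2) + (if \<bar>b\<bar> = \<infinity> then 0 else 1 / (x - real_of_ereal b)\<^sup>2)"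
    by (rule real_exhaustion_slit_plane)
  show ?case
    unfolding jet_dense_def
  proof (intro allI impI)
    fix f e assume "C_m_on 0 (einterval a b) f" and e: "locally_bounded_below (einterval a b) e"
    then have f: "continuous_on (einterval a b) f" by (simp add: C_m_on_def iter_vector_deriv_def)
    obtain g where "g holomorphic_on slit_plane a b" "\<And>x. x \<in> einterval a b \<Longrightarrow> cmod (f x - g (of_real x)) < e x"
      by (rule Carleman_approximation[OF f e]) (assumption | rule that)+
    then show "\<exists>g. g holomorphic_on slit_plane a b \<and>
        (\<forall>x\<in>einterval a b. \<forall>i\<le>0. cmod (iter_vector_deriv i f x - (deriv ^^ i) g (of_real x)) < e x)"
      by (intro exI[of _ g]) (simp add: iter_vector_deriv_def)
  qed
next
  case (Suc m)
  have "complex_of_real ` einterval a b \<subseteq> slit_plane a b"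
    by (intro image_subsetI iffD2[OF of_real_in_slit_plane])
  then show ?case
    by (rule jet_dense_Suc[OF Suc assms open_slit_plane starlike_slit_plane[OF assms]])
qed

theorem theorem3:
  fixes m :: nat and a b :: ereal
    and f :: "real \<Rightarrow> complex" and \<epsilon> :: "real \<Rightarrow> real"
  assumes "a \<le> b"
    and "C_m_on m (einterval a b) f"
    and "continuous_on (einterval a b) \<epsilon>"
    and "\<forall>x\<in>einterval a b. \<epsilon> x > 0"
  shows "\<exists>g :: complex \<Rightarrow> complex.
           g holomorphic_on (UNIV - complex_of_real ` (UNIV - einterval a b)) \<and>
           (\<forall>x\<in>einterval a b. \<forall>i\<le>m.
              cmod (iter_vector_deriv i f x - (deriv ^^ i) g (complex_of_real x)) < \<epsilon> x)"
proof (cases "einterval a b = {}")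
  case True
  then show ?thesis by (intro exI[of _ "\<lambda>_. 0"]) simp
next
  case False
  then obtain p where p: "p \<in> einterval a b" by blast
  have "locally_bounded_below (einterval a b) \<epsilon>"
    using assms(3,4) by (intro locally_bounded_below_continuous) auto
  then show ?thesis
    using jet_dense_slit_plane[OF p, of m] assms(2) unfolding jet_dense_def by simp
qed

end
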